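(* Let $A,B\in\mathbb{P}_n^+$ and let $g,h$ be matrix monotone functions on $[0,\infty)$ taking positive values on $(0,\infty)$, such that for all $x>0$: (i) $g\!\left(\frac{1}{h(x)}\right)\le \frac{1}{h(g(x))}$; (ii) $g\!\left(\frac{x}{h(x)}\right)\le \frac{g(x)}{h(g(x))}$; (iii) $h(x g(x))\le h(x)\,h(g(x))$. Let $f(x)=xg(x)$ and let $f^{k}=f\circ\cdots\circ f$ ($k$-fold composition). Then for every positive integer $k$, $$A\sigma_h B\le I\quad\Longrightarrow\quad f^{k}(A)\,\sigma_h\, f^{k}(B)\le I.$$ If all three inequalities (i)–(iii) are reversed, then for every positive integer $k$, $$A\sigma_h B\ge I\quad\Longrightarrow\quad f^{k}(A)\,\sigma_h\, f^{k}(B)\ge I.$$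
   Context: $\mathbb{P}_n^+$ denotes the set of $n\times n$ complex positive definite matrices, $I$ the identity, $\le$ the Löwner order, and $f(A)$ is defined by functional calculus. A real function $h$ is matrix monotone if $X\le Y$ implies $h(X)\le h(Y)$ for Hermitian matrices of all sizes with spectra in its domain. For a positive matrix monotone function $h$ and $A,B\in\mathbb{P}_n^+$, $A\sigma_h B:=A^{1/2}h(A^{-1/2}BA^{-1/2})A^{1/2}$. *)

theory Defs
  imports Complex_Main "Jordan_Normal_Form.Char_Poly"
begin

definition cadj :: "complex mat \<Rightarrow> complex mat" where
  "cadj A = mat (dim_col A) (dim_row A) (\<lambda>(i,j). cnj (A $$ (j,i)))"

definition hermitian :: "complex mat \<Rightarrow> bool" where
  "hermitian A \<longleftrightarrow> A \<in> carrier_mat (dim_row A) (dim_row A) \<and> cadj A = A"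

definition unitary :: "nat \<Rightarrow> complex mat \<Rightarrow> bool" where
  "unitary n U \<longleftrightarrow> U \<in> carrier_mat n n \<and> U * cadj U = 1\<^sub>m n \<and> cadj U * U = 1\<^sub>m n"

definition psd :: "complex mat \<Rightarrow> bool" where
  "psd A \<longleftrightarrow> hermitian A \<and>
     (\<forall>v \<in> carrier_vec (dim_row A). 0 \<le> Re (conjugate v \<bullet> (A *\<^sub>v v)))"

definition pd :: "nat \<Rightarrow> complex mat \<Rightarrow> bool" where
  "pd n A \<longleftrightarrow> A \<in> carrier_mat n n \<and> hermitian A \<and>
     (\<forall>v \<in> carrier_vec n. v \<noteq> 0\<^sub>v n \<longrightarrow> 0 < Re (conjugate v \<bullet> (A *\<^sub>v v)))"

definition loewner_le :: "complex mat \<Rightarrow> complex mat \<Rightarrow> bool" where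
  "loewner_le A B \<longleftrightarrow> hermitian A \<and> hermitian B \<and> dim_row A = dim_row B \<and> psd (B - A)"

definition rdiag :: "nat \<Rightarrow> (nat \<Rightarrow> real) \<Rightarrow> complex mat" where
  "rdiag n d = mat n n (\<lambda>(i,j). if i = j then complex_of_real (d i) else 0)"

definition matfun :: "(real \<Rightarrow> real) \<Rightarrow> complex mat \<Rightarrow> complex mat" where
  "matfun f A = (SOME B. \<exists>U d. unitary (dim_row A) U \<and>
       A = U * rdiag (dim_row A) d * cadj U \<and>
       B = U * rdiag (dim_row A) (\<lambda>i. f (d i)) * cadj U)"

definition spec_in :: "real set \<Rightarrow> complex mat \<Rightarrow> bool" where
  "spec_in S A \<longleftrightarrow> (\<forall>k. eigenvalue A k \<longrightarrow> k \<in> complex_of_real ` S)"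

definition matrix_monotone_on :: "real set \<Rightarrow> (real \<Rightarrow> real) \<Rightarrow> bool" where
  "matrix_monotone_on S h \<longleftrightarrow>
     (\<forall>X Y. hermitian X \<longrightarrow> hermitian Y \<longrightarrow> spec_in S X \<longrightarrow> spec_in S Y \<longrightarrow>
        loewner_le X Y \<longrightarrow> loewner_le (matfun h X) (matfun h Y))"

definition mean_sigma :: "(real \<Rightarrow> real) \<Rightarrow> complex mat \<Rightarrow> complex mat \<Rightarrow> complex mat" where
  "mean_sigma h A B =
     (let S = matfun sqrt A; T = matfun (\<lambda>x. 1 / sqrt x) A
      in S * matfun h (T * B * T) * S)"

end

theory Submission
  imports Defs "Jordan_Normal_Form.Spectral_Radius" "Jordan_Normal_Form.Schur_Decomposition"
begin

text \<open>
  Put \<open>C = A\<^sup>-\<^sup>1\<^sup>/\<^sup>2 B A\<^sup>-\<^sup>1\<^sup>/\<^sup>2\<close>, so that the hypothesis reads \<open>A \<le> h(C)\<^sup>-\<^sup>1\<close>. Since \<open>X g(X\<^sup>* X) X\<^sup>* = f(X X\<^sup>*)\<close>,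
  congruence by \<open>A\<^sup>1\<^sup>/\<^sup>2\<close> turns \<open>f(A) \<sigma> f(B)\<close> into \<open>g(A) \<sigma> C\<^sup>1\<^sup>/\<^sup>2 g(C\<^sup>1\<^sup>/\<^sup>2 A C\<^sup>1\<^sup>/\<^sup>2) C\<^sup>1\<^sup>/\<^sup>2\<close>. By
  monotonicity of \<open>g\<close> and (i), (ii) its arguments are at most \<open>1/h(g(C))\<close> and \<open>C g(C)/h(g(C))\<close>;
  as the mean is jointly monotone, it is at most \<open>h(C g(C))/h(g(C)) \<le> h(C)\<close> by (iii). Thus
  \<open>f(A) \<sigma> f(B) \<le> A \<sigma> B \<le> I\<close>, and one iterates; the reversed case is symmetric.

  Monotonicity of the mean in its first argument is Hansen's inequality \<open>K\<^sup>* h(X) K \<le> h(K\<^sup>* X K)\<close>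
  for contractions \<open>K\<close>. As nothing is known about \<open>h(0)\<close> and continuity of \<open>h\<close> is not assumed, it is
  first proved up to a factor \<open>1 + e\<close> inside \<open>h\<close>, which is then removed using \<open>h(t x) \<le> t h(x)\<close>, \<open>t > 1\<close>,
  itself the \<open>1 \<times> 1\<close> case of the approximate inequality.
\<close>

section \<open>Matrix algebra, quadratic forms and the Loewner order\<close>

text \<open>The ring laws are phrased with equations between dimensions instead of carrier sets: as
  conditional rewrite rules they let the simplifier discharge the side conditions itself and
  normalise whole products.\<close>

lemma mat_mult_assoc_dim:
  fixes A B C :: "complex mat"
  assumes "dim_col A = dim_row B" "dim_col B = dim_row C"
  shows "A * B * C = A * (B * C)"
  by (rule assoc_mult_mat[of _ "dim_row A" "dim_row B" _ "dim_row C" _ "dim_col C"]) (use assms in auto)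

lemma mat_mult_vec_assoc_dim:
  fixes A B :: "complex mat"
  assumes "dim_col A = dim_row B" "dim_col B = dim_vec v"
  shows "A * B *\<^sub>v v = A *\<^sub>v (B *\<^sub>v v)"
  by (rule assoc_mult_mat_vec[of _ "dim_row A" "dim_row B" _ "dim_vec v"])
     (use assms in \<open>auto intro: carrier_vecI\<close>)

lemma mat_left_one_dim:
  fixes A :: "complex mat"
  assumes "dim_row A = n" shows "1\<^sub>m n * A = A"
  by (rule left_mult_one_mat[of _ _ "dim_col A"]) (use assms in auto)

lemma mat_right_one_dim:
  fixes A :: "complex mat"
  assumes "dim_col A = n" shows "A * 1\<^sub>m n = A"
  by (rule right_mult_one_mat[of _ "dim_row A"]) (use assms in auto)

lemma mat_add_mult_dim:
  fixes A B C :: "complex mat"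
  assumes "dim_row A = dim_row B" "dim_col A = dim_row C" "dim_col B = dim_row C"
  shows "(A + B) * C = A * C + B * C"
  by (rule add_mult_distrib_mat[of _ "dim_row A" "dim_row C" _ _ "dim_col C"]) (use assms in auto)

lemma mat_mult_add_dim:
  fixes A B C :: "complex mat"
  assumes "dim_col A = dim_row B" "dim_row C = dim_row B" "dim_col B = dim_col C"
  shows "A * (B + C) = A * B + A * C"
  by (rule mult_add_distrib_mat[of _ "dim_row A" "dim_row B" _ "dim_col C"]) (use assms in auto)

lemma mat_minus_mult_dim:
  fixes A B C :: "complex mat"
  assumes "dim_row A = dim_row B" "dim_col A = dim_row C" "dim_col B = dim_row C"
  shows "(A - B) * C = A * C - B * C"
  by (rule minus_mult_distrib_mat[of _ "dim_row A" "dim_row C" _ _ "dim_col C"]) (use assms in auto)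

lemma mat_mult_minus_dim:
  fixes A B C :: "complex mat"
  assumes "dim_col A = dim_row B" "dim_row C = dim_row B" "dim_col B = dim_col C"
  shows "A * (B - C) = A * B - A * C"
  by (rule mult_minus_distrib_mat[of _ "dim_row A" "dim_row B" _ "dim_col C"]) (use assms in auto)

lemma mat_smult_mult_dim:
  fixes A B :: "complex mat"
  assumes "dim_col A = dim_row B"
  shows "(c \<cdot>\<^sub>m A) * B = c \<cdot>\<^sub>m (A * B)"
  by (rule mult_smult_assoc_mat[of _ "dim_row A" "dim_row B" _ "dim_col B"]) (use assms in auto)

lemma mat_mult_smult_dim:
  fixes A B :: "complex mat"
  assumes "dim_col A = dim_row B"
  shows "A * (c \<cdot>\<^sub>m B) = c \<cdot>\<^sub>m (A * B)"
  by (rule mult_smult_distrib[of _ "dim_row A" "dim_row B" _ "dim_col B"]) (use assms in auto)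

lemma mat_smult_smult: "a \<cdot>\<^sub>m (b \<cdot>\<^sub>m A) = (a * b :: complex) \<cdot>\<^sub>m A"
  by (rule eq_matI) auto

lemma mat_zero_mult_dim:
  fixes M :: "complex mat"
  assumes "dim_row M = b" shows "0\<^sub>m a b * M = 0\<^sub>m a (dim_col M)"
  using assms by (intro left_mult_zero_mat) auto

lemma mat_mult_zero_dim:
  fixes M :: "complex mat"
  assumes "dim_col M = a" shows "M * 0\<^sub>m a b = 0\<^sub>m (dim_row M) b"
  using assms by (intro right_mult_zero_mat) auto

lemma mat_smult_zero: "c \<cdot>\<^sub>m 0\<^sub>m a b = (0\<^sub>m a b :: complex mat)"
  by (intro eq_matI) auto

lemma mat_add_zero_dim:
  fixes M :: "complex mat"
  assumes "dim_row M = a" "dim_col M = b"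
  shows "M + 0\<^sub>m a b = M" "0\<^sub>m a b + M = M"
  using assms by (auto intro!: eq_matI)

text \<open>Products are normalised to the right, so an inverse pair appears in front of a remaining
  factor \<open>C\<close>; this form cancels it there.\<close>

lemma mat_cancel_left:
  fixes A B C :: "complex mat"
  assumes "A * B = 1\<^sub>m n" "dim_col A = dim_row B" "dim_row C = n"
  shows "A * (B * C) = C"
proof -
  have "dim_col B = n" using assms(1) by (metis index_mult_mat(3) index_one_mat(3))
  then have "A * (B * C) = A * B * C" using assms(2,3) by (simp add: mat_mult_assoc_dim)
  then show ?thesis using assms by (simp add: mat_left_one_dim)
qed

lemmas mat_dim_simps = mat_mult_assoc_dim mat_add_mult_dim mat_mult_add_dim mat_minus_mult_dim
  mat_mult_minus_dim mat_smult_mult_dim mat_mult_smult_dim mat_left_one_dim mat_right_one_dim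
  mat_smult_smult mat_zero_mult_dim mat_mult_zero_dim mat_smult_zero mat_add_zero_dim

section \<open>Conjugate transpose and Hermitian matrices\<close>

lemma cadj_dim [simp]: "dim_row (cadj A) = dim_col A" "dim_col (cadj A) = dim_row A"
  by (auto simp: cadj_def)

lemma cadj_index: "i < dim_col A \<Longrightarrow> j < dim_row A \<Longrightarrow> cadj A $$ (i,j) = cnj (A $$ (j,i))"
  by (auto simp: cadj_def)

lemma cadj_cadj [simp]: "cadj (cadj A) = A"
  by (rule eq_matI) (auto simp: cadj_index)

lemma cadj_one [simp]: "cadj (1\<^sub>m n) = 1\<^sub>m n"
  by (rule eq_matI) (auto simp: cadj_index)

lemma cadj_mult:
  assumes "dim_col A = dim_row B"
  shows "cadj (A * B) = cadj B * cadj A"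
  by (rule eq_matI) (use assms in \<open>auto simp: cadj_index scalar_prod_def mult.commute\<close>)

lemma cadj_add:
  assumes "dim_row A = dim_row B" "dim_col A = dim_col B"
  shows "cadj (A + B) = cadj A + cadj B"
  by (rule eq_matI) (use assms in \<open>auto simp: cadj_index\<close>)

lemma cadj_minus:
  assumes "dim_row A = dim_row B" "dim_col A = dim_col B"
  shows "cadj (A - B) = cadj A - cadj B"
  by (rule eq_matI) (use assms in \<open>auto simp: cadj_index\<close>)

lemma cadj_smult: "cadj (c \<cdot>\<^sub>m A) = cnj c \<cdot>\<^sub>m cadj A"
  by (rule eq_matI) (auto simp: cadj_index)

lemma hermitian_iff: "hermitian A \<longleftrightarrow> dim_col A = dim_row A \<and> cadj A = A"
  by (auto simp: hermitian_def)

lemma hermitianD: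
  assumes "hermitian A" shows "dim_col A = dim_row A" "cadj A = A"
  using assms by (auto simp: hermitian_iff)

lemma hermitian_one: "hermitian (1\<^sub>m n)"
  by (simp add: hermitian_iff)

lemma hermitian_congruence:
  "hermitian A \<Longrightarrow> dim_row C = dim_row A \<Longrightarrow> hermitian (cadj C * A * C)"
  by (simp add: hermitian_iff cadj_mult mat_mult_assoc_dim)

lemma hermitian_add:
  "hermitian A \<Longrightarrow> hermitian B \<Longrightarrow> dim_row A = dim_row B \<Longrightarrow> hermitian (A + B)"
  by (simp add: hermitian_iff cadj_add)

lemma hermitian_minus:
  "hermitian A \<Longrightarrow> hermitian B \<Longrightarrow> dim_row A = dim_row B \<Longrightarrow> hermitian (A - B)"
  by (simp add: hermitian_iff cadj_minus)

lemma hermitian_smult: "hermitian A \<Longrightarrow> hermitian (complex_of_real c \<cdot>\<^sub>m A)"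
  by (simp add: hermitian_iff cadj_smult)

section \<open>Quadratic forms\<close>

text \<open>For Hermitian \<open>A\<close> the form is real anyway, so taking the real part loses
  nothing, and the Loewner order turns into inequalities between real numbers.\<close>

definition qform :: "complex mat \<Rightarrow> complex vec \<Rightarrow> real" where
  "qform A v = Re (conjugate v \<bullet> (A *\<^sub>v v))"

lemma qform_sum:
  assumes "dim_row A = dim_vec v" "dim_col A = dim_vec v"
  shows "qform A v = Re (\<Sum>i<dim_vec v. \<Sum>j<dim_vec v. cnj (v $ i) * A $$ (i,j) * v $ j)"
  using assms by (simp add: qform_def scalar_prod_def sum_distrib_left mult.assoc lessThan_atLeast0)

lemma qform_add:
  assumes "dim_row A = n" "dim_col A = n" "dim_row B = n" "dim_col B = n" "dim_vec v = n"
  shows "qform (A + B) v = qform A v + qform B v"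
  using assms by (simp add: qform_sum algebra_simps sum.distrib)

lemma qform_minus:
  assumes "dim_row A = n" "dim_col A = n" "dim_row B = n" "dim_col B = n" "dim_vec v = n"
  shows "qform (A - B) v = qform A v - qform B v"
  using assms by (simp add: qform_sum algebra_simps sum_subtractf)

lemma qform_smult:
  assumes "dim_row A = n" "dim_col A = n" "dim_vec v = n"
  shows "qform (complex_of_real c \<cdot>\<^sub>m A) v = c * qform A v"
proof -
  have "(\<Sum>i<n. \<Sum>j<n. cnj (v $ i) * (complex_of_real c * A $$ (i,j)) * v $ j)
     = complex_of_real c * (\<Sum>i<n. \<Sum>j<n. cnj (v $ i) * A $$ (i,j) * v $ j)"
    by (simp add: sum_distrib_left mult_ac)
  then show ?thesis using assms by (simp add: qform_sum)
qed

lemma adjoint_scalar_prod: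
  assumes "dim_col C = dim_vec v" "dim_row C = dim_vec w"
  shows "conjugate v \<bullet> (cadj C *\<^sub>v w) = conjugate (C *\<^sub>v v) \<bullet> w"
proof -
  have "conjugate v \<bullet> (cadj C *\<^sub>v w) = (\<Sum>i<dim_vec v. \<Sum>j<dim_vec w. cnj (v $ i) * cnj (C $$ (j,i)) * w $ j)"
    using assms by (simp add: scalar_prod_def sum_distrib_left mult.assoc lessThan_atLeast0 cadj_index)
  also have "\<dots> = (\<Sum>j<dim_vec w. \<Sum>i<dim_vec v. cnj (v $ i) * cnj (C $$ (j,i)) * w $ j)"
    by (rule sum.swap)
  also have "\<dots> = conjugate (C *\<^sub>v v) \<bullet> w"
    using assms by (simp add: scalar_prod_def sum_distrib_left sum_distrib_right lessThan_atLeast0 mult_ac)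
  finally show ?thesis .
qed

lemma qform_congruence:
  assumes "dim_row C = dim_row A" "dim_col A = dim_row A" "dim_vec v = dim_col C"
  shows "qform (cadj C * A * C) v = qform A (C *\<^sub>v v)"
  using assms by (simp add: qform_def mat_mult_assoc_dim mat_mult_vec_assoc_dim adjoint_scalar_prod)

lemma qform_one: "dim_vec v = n \<Longrightarrow> qform (1\<^sub>m n) v = (\<Sum>i<n. (cmod (v $ i))\<^sup>2)"
proof -
  assume n: "dim_vec v = n"
  have "qform (1\<^sub>m n) v = Re (conjugate v \<bullet> v)" using n carrier_vecI[of v n] by (simp add: qform_def)
  also have "conjugate v \<bullet> v = complex_of_real (\<Sum>i<n. (cmod (v $ i))\<^sup>2)"
    using n by (simp add: scalar_prod_def lessThan_atLeast0 complex_norm_square[symmetric] mult.commute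
        del: of_real_power)
  finally show ?thesis by simp
qed

lemma qform_one_nonneg: "dim_vec v = n \<Longrightarrow> qform (1\<^sub>m n) v \<ge> 0"
  by (simp add: qform_one sum_nonneg)

lemma qform_one_pos:
  assumes "dim_vec v = n" "v \<noteq> 0\<^sub>v n" shows "qform (1\<^sub>m n) v > 0"
proof -
  obtain i where i: "i < n" "v $ i \<noteq> 0" using assms by (metis eq_vecI index_zero_vec)
  have "(cmod (v $ i))\<^sup>2 \<le> (\<Sum>i<n. (cmod (v $ i))\<^sup>2)"
    by (rule member_le_sum) (use i in auto)
  then show ?thesis using i assms by (simp add: qform_one) (smt (verit) zero_less_norm_iff zero_less_power)
qed

section \<open>Positivity and the Loewner order\<close>

lemma psd_iff: "psd A \<longleftrightarrow> hermitian A \<and> (\<forall>v. dim_vec v = dim_row A \<longrightarrow> 0 \<le> qform A v)"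
  unfolding psd_def qform_def by (metis carrier_vecI carrier_vecD)

lemma pd_iff:
  "pd n A \<longleftrightarrow> dim_row A = n \<and> hermitian A \<and> (\<forall>v. dim_vec v = n \<longrightarrow> v \<noteq> 0\<^sub>v n \<longrightarrow> 0 < qform A v)"
  unfolding pd_def qform_def hermitian_def
  by (metis carrier_vecI carrier_vecD carrier_matD(1))

lemma pdD:
  assumes "pd n A" shows "dim_row A = n" "dim_col A = n" "hermitian A" "cadj A = A"
  using assms by (auto simp: pd_iff hermitian_iff)

lemma loewner_le_iff:
  "loewner_le A B \<longleftrightarrow> hermitian A \<and> hermitian B \<and> dim_row A = dim_row B \<and>
     (\<forall>v. dim_vec v = dim_row A \<longrightarrow> qform A v \<le> qform B v)"
proof -
  have "psd (B - A) \<longleftrightarrow> (\<forall>v. dim_vec v = dim_row A \<longrightarrow> qform A v \<le> qform B v)"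
    if "hermitian A" "hermitian B" "dim_row A = dim_row B"
    using that hermitianD[OF that(1)] hermitianD[OF that(2)]
    by (simp add: psd_iff hermitian_minus qform_minus[of _ "dim_row A"])
  then show ?thesis unfolding loewner_le_def by blast
qed

lemma loewner_le_trans: "loewner_le A B \<Longrightarrow> loewner_le B C \<Longrightarrow> loewner_le A C"
  by (force simp: loewner_le_iff)

lemma loewner_le_congruence:
  assumes "loewner_le A B" "dim_row C = dim_row A"
  shows "loewner_le (cadj C * A * C) (cadj C * B * C)"
  using assms by (auto simp: loewner_le_iff hermitian_congruence qform_congruence hermitianD)

lemma pd_nonneg: "pd n A \<Longrightarrow> dim_vec v = n \<Longrightarrow> 0 \<le> qform A v"
  by (cases "v = 0\<^sub>v n") (auto simp: pd_iff hermitian_iff qform_sum intro: less_imp_le)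

lemma pd_loewner_le: "pd n A \<Longrightarrow> loewner_le A B \<Longrightarrow> pd n B"
  by (auto simp: pd_iff loewner_le_iff intro: less_le_trans)

text \<open>The left inverse \<open>D\<close> makes \<open>C\<close> injective, so a nonzero
  \<open>v\<close> is sent to a nonzero vector, where the form of \<open>A\<close> is positive.
  \<open>C\<close> may be rectangular.\<close>

lemma pd_congruence:
  assumes "pd n A" "dim_row C = n" "D * C = 1\<^sub>m m" "dim_col D = n"
  shows "pd m (cadj C * A * C)"
proof -
  have m: "dim_col C = m" "dim_row D = m"
    using assms(3) by (metis index_mult_mat(3) index_one_mat(3), metis index_mult_mat(2) index_one_mat(2))
  have "C *\<^sub>v v \<noteq> 0\<^sub>v n" if "dim_vec v = m" "v \<noteq> 0\<^sub>v m" for v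
  proof
    assume "C *\<^sub>v v = 0\<^sub>v n"
    then have "D * C *\<^sub>v v = D *\<^sub>v 0\<^sub>v n" using assms(2,4) m that by (simp add: mat_mult_vec_assoc_dim)
    also have "D *\<^sub>v 0\<^sub>v n = 0\<^sub>v m" using assms m by (intro eq_vecI) (auto simp: scalar_prod_def)
    finally show False using assms that carrier_vecI[of v m] by simp
  qed
  then show ?thesis using assms m pdD[OF assms(1)]
    by (simp add: pd_iff hermitian_congruence qform_congruence)
qed

lemma pd_one: "pd n (1\<^sub>m n)"
  by (simp add: pd_iff hermitian_one qform_one_pos)

lemma pd_smult: "pd n A \<Longrightarrow> c > 0 \<Longrightarrow> pd n (complex_of_real c \<cdot>\<^sub>m A)"
  by (auto simp: pd_iff hermitian_smult qform_smult[of _ n] hermitianD(1))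

section \<open>The spectral theorem\<close>

text \<open>With \<open>inj_right\<close>, the isometric embeddings of the first \<open>p\<close>
  and the last \<open>q\<close> coordinates. Block matrices are written as sums of products with
  these embeddings and their adjoints, so that block computations become algebra with the relations
  \<open>inj_isometry\<close> and \<open>inj_complete\<close>.\<close>

definition inj_left :: "nat \<Rightarrow> nat \<Rightarrow> complex mat" where
  "inj_left p q = mat (p + q) p (\<lambda>(i,j). if i = j then 1 else 0)"

definition inj_right :: "nat \<Rightarrow> nat \<Rightarrow> complex mat" where
  "inj_right p q = mat (p + q) q (\<lambda>(i,j). if i = p + j then 1 else 0)"

lemma inj_dim [simp]:
  "dim_row (inj_left p q) = p + q" "dim_col (inj_left p q) = p"
  "dim_row (inj_right p q) = p + q" "dim_col (inj_right p q) = q"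
  by (auto simp: inj_left_def inj_right_def)

lemma inj_isometry:
  "cadj (inj_left p q) * inj_left p q = 1\<^sub>m p"
  "cadj (inj_right p q) * inj_right p q = 1\<^sub>m q"
  "cadj (inj_right p q) * inj_left p q = 0\<^sub>m q p"
  "cadj (inj_left p q) * inj_right p q = 0\<^sub>m p q"
  by (rule eq_matI; auto simp: scalar_prod_def cadj_index inj_left_def inj_right_def if_distrib
      cong: if_cong)+

lemma inj_orthogonal_cancel:
  "dim_row M = q \<Longrightarrow> cadj (inj_left p q) * (inj_right p q * M) = 0\<^sub>m p (dim_col M)"
  "dim_row M = p \<Longrightarrow> cadj (inj_right p q) * (inj_left p q * M) = 0\<^sub>m q (dim_col M)"
  by (simp_all flip: mat_mult_assoc_dim add: inj_isometry mat_zero_mult_dim)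

lemmas inj_cancel = inj_isometry inj_orthogonal_cancel
  mat_cancel_left[OF inj_isometry(1)] mat_cancel_left[OF inj_isometry(2)]

lemma inj_complete:
  "inj_left p q * cadj (inj_left p q) + inj_right p q * cadj (inj_right p q) = 1\<^sub>m (p + q)"
proof (rule eq_matI)
  fix i j assume "i < dim_row (1\<^sub>m (p + q))" "j < dim_col (1\<^sub>m (p + q))"
  then have ij: "i < p + q" "j < p + q" by auto
  have 1: "(inj_left p q * cadj (inj_left p q)) $$ (i,j) = (if i = j \<and> i < p then 1 else 0)"
    using ij by (auto simp: scalar_prod_def cadj_index inj_left_def if_distrib cong: if_cong)
  have "(inj_right p q * cadj (inj_right p q)) $$ (i,j)
     = (\<Sum>k\<in>{0..<q}. (if i = p + k then 1 else 0) * (if j = p + k then 1 else 0))"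
    using ij by (auto simp: scalar_prod_def cadj_index inj_right_def intro!: sum.cong)
  also have "\<dots> = (\<Sum>k\<in>{0..<q}. if k = i - p then (if i = j \<and> i \<ge> p then 1 else 0) else 0)"
    by (rule sum.cong) auto
  also have "\<dots> = (if i = j \<and> i \<ge> p then 1 else 0)" using ij by auto
  finally show "(inj_left p q * cadj (inj_left p q) + inj_right p q * cadj (inj_right p q)) $$ (i,j)
     = 1\<^sub>m (p + q) $$ (i,j)"
    using 1 ij by (simp del: index_mult_mat(1))
qed auto

lemma rdiag_dim [simp]: "dim_row (rdiag n d) = n" "dim_col (rdiag n d) = n"
  by (auto simp: rdiag_def)

lemma cadj_rdiag [simp]: "cadj (rdiag n d) = rdiag n d"
  by (rule eq_matI) (auto simp: cadj_index rdiag_def)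

lemma rdiag_mult: "rdiag n d * rdiag n e = rdiag n (\<lambda>i. d i * e i)"
  by (rule eq_matI) (auto simp: rdiag_def scalar_prod_def if_distrib cong: if_cong)

lemma rdiag_mult_index:
  assumes "dim_row M = n" "i < n" "j < dim_col M"
  shows "(rdiag n d * M) $$ (i,j) = d i * M $$ (i,j)"
proof -
  have "(rdiag n d * M) $$ (i,j) = (\<Sum>k\<in>{0..<n}. (if i = k then complex_of_real (d i) else 0) * M $$ (k,j))"
    using assms by (simp add: scalar_prod_def rdiag_def)
  also have "\<dots> = (\<Sum>k\<in>{0..<n}. if k = i then d i * M $$ (i,j) else 0)"
    by (rule sum.cong) auto
  finally show ?thesis using assms by simp
qed

lemma mult_rdiag_index:
  assumes "dim_col M = n" "i < dim_row M" "j < n"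
  shows "(M * rdiag n d) $$ (i,j) = M $$ (i,j) * d j"
proof -
  have "(M * rdiag n d) $$ (i,j) = (\<Sum>k\<in>{0..<n}. M $$ (i,k) * (if k = j then complex_of_real (d k) else 0))"
    using assms by (simp add: scalar_prod_def rdiag_def)
  also have "\<dots> = (\<Sum>k\<in>{0..<n}. if k = j then M $$ (i,j) * d j else 0)"
    by (rule sum.cong) auto
  finally show ?thesis using assms by simp
qed

text \<open>Each embedding intertwines the whole diagonal matrix with its own part of it; inserting
  \<open>inj_complete\<close> on the right then splits the matrix.\<close>

lemma rdiag_split:
  "rdiag (p + q) d = inj_left p q * rdiag p d * cadj (inj_left p q)
     + inj_right p q * rdiag q (\<lambda>i. d (p + i)) * cadj (inj_right p q)"
proof -
  have 1: "rdiag (p + q) d * inj_left p q = inj_left p q * rdiag p d"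
    by (rule eq_matI) (auto simp: rdiag_mult_index mult_rdiag_index inj_left_def simp del: index_mult_mat(1))
  have 2: "rdiag (p + q) d * inj_right p q = inj_right p q * rdiag q (\<lambda>i. d (p + i))"
    by (rule eq_matI) (auto simp: rdiag_mult_index mult_rdiag_index inj_right_def simp del: index_mult_mat(1))
  have "rdiag (p + q) d = rdiag (p + q) d *
      (inj_left p q * cadj (inj_left p q) + inj_right p q * cadj (inj_right p q))"
    by (simp add: inj_complete mat_right_one_dim)
  also have "\<dots> = rdiag (p + q) d * inj_left p q * cadj (inj_left p q)
      + rdiag (p + q) d * inj_right p q * cadj (inj_right p q)"
    by (simp add: mat_dim_simps)
  finally show ?thesis unfolding 1 2 .
qed

section \<open>Unitary matrices and diagonalisation\<close>

lemma unitaryD: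
  assumes "unitary n U"
  shows "dim_row U = n" "dim_col U = n" "U * cadj U = 1\<^sub>m n" "cadj U * U = 1\<^sub>m n"
  using assms by (auto simp: unitary_def)

lemma unitaryI:
  assumes "dim_row U = n" "dim_col U = n" "cadj U * U = 1\<^sub>m n"
  shows "unitary n U"
proof -
  have "U * cadj U = 1\<^sub>m n"
    by (rule mat_mult_left_right_inverse[OF _ _ assms(3)]) (use assms in auto)
  then show ?thesis using assms unfolding unitary_def by auto
qed

text \<open>Complete \<open>v\<close> to a basis, orthogonalise by Gram-Schmidt, which keeps the
  first vector, and normalise the columns; the scalar \<open>c\<close> absorbs the
  normalisation.\<close>

lemma unitary_with_first_col:
  assumes v: "v \<in> carrier_vec n" "v \<noteq> 0\<^sub>v n"
  shows "\<exists>U c. unitary n U \<and> col U 0 = c \<cdot>\<^sub>v v"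
proof -
  interpret cof_vec_space n "TYPE(complex)" .
  define b where "b = basis_completion v"
  define ws where "ws = gram_schmidt n b"
  have n: "n \<noteq> 0" using v by auto
  from basis_completion[OF v, folded b_def]
  have dist_b: "distinct b" and indep: "\<not> lin_dep (set b)" and b: "set b \<subseteq> carrier_vec n"
    and hdb: "hd b = v" and len_b: "length b = n" by auto
  from hdb len_b n obtain vs where bv: "b = v # vs" by (cases b, auto)
  from gram_schmidt_result[OF b dist_b indep refl, folded ws_def]
  have ws: "set ws \<subseteq> carrier_vec n" "corthogonal ws" "length ws = n" by (auto simp: len_b)
  from gram_schmidt_hd[OF v(1), of vs, folded bv] have "hd ws = v" unfolding ws_def .
  then have ws0: "ws ! 0 = v" using ws(3) n by (metis hd_conv_nth length_0_conv)
  \<comment> \<open>Reciprocal norms: the vectors \<open>ws\<close> are orthogonal and nonzero, but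
    not of unit length.\<close>
  define c where "c = (\<lambda>j. complex_of_real (1 / sqrt (Re (conjugate (ws ! j) \<bullet> (ws ! j)))))"
  define U where "U = mat_of_cols n (map (\<lambda>j. c j \<cdot>\<^sub>v (ws ! j)) [0..<n])"
  have dimU: "dim_row U = n" "dim_col U = n" unfolding U_def by auto
  have wsc: "ws ! j \<in> carrier_vec n" if "j < n" for j using ws that by auto
  have colU: "col U j = c j \<cdot>\<^sub>v (ws ! j)" if "j < n" for j
    unfolding U_def by (subst col_mat_of_cols) (use that wsc in auto)
  have Uij: "U $$ (i,j) = c j * ws ! j $ i" if "i < n" "j < n" for i j
    using colU[OF that(2)] that dimU wsc[OF that(2)] by (metis carrier_vecD index_col index_smult_vec(1))
  have "cadj U * U = 1\<^sub>m n"
  proof (rule eq_matI)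
    fix i j assume "i < dim_row (1\<^sub>m n)" "j < dim_col (1\<^sub>m n)"
    then have ij: "i < n" "j < n" by auto
    have d: "dim_vec (ws ! i) = n" "dim_vec (ws ! j) = n" using wsc ij carrier_vecD by blast+
    have "(cadj U * U) $$ (i,j) = cnj (c i) * c j * (conjugate (ws ! i) \<bullet> ws ! j)"
      using ij dimU d by (simp add: scalar_prod_def cadj_index Uij sum_distrib_left mult_ac)
    also have "\<dots> = (if i = j then 1 else 0)"
    proof (cases "i = j")
      case False
      then have "ws ! j \<bullet>c ws ! i = 0" using corthogonalD[OF ws(2), of j i] ij ws(3) by auto
      then have "conjugate (ws ! i) \<bullet> ws ! j = 0"
        using conjugate_vec_sprod_comm[OF wsc[OF ij(2)] wsc[OF ij(1)]] by simp
      then show ?thesis using False by simp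
    next
      case True
      have eq: "conjugate (ws ! i) \<bullet> ws ! i = complex_of_real (\<Sum>k<n. (cmod (ws ! i $ k))\<^sup>2)"
        using d by (simp add: scalar_prod_def lessThan_atLeast0 complex_norm_square[symmetric] mult.commute
          del: of_real_power)
      have "ws ! i \<bullet>c ws ! i \<noteq> 0" using corthogonalD[OF ws(2), of i i] ij ws(3) by auto
      then have "conjugate (ws ! i) \<bullet> ws ! i \<noteq> 0"
        using conjugate_vec_sprod_comm[OF wsc[OF ij(1)] wsc[OF ij(1)]] by simp
      then have "(\<Sum>k<n. (cmod (ws ! i $ k))\<^sup>2) \<noteq> 0" using eq by (metis of_real_0)
      moreover have "(\<Sum>k<n. (cmod (ws ! i $ k))\<^sup>2) \<ge> 0" by (simp add: sum_nonneg)
      ultimately have "(\<Sum>k<n. (cmod (ws ! i $ k))\<^sup>2) > 0" by linarith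
      moreover have "1 / sqrt r * (1 / sqrt r) * r = 1" if "r > 0" for r using that by simp
      ultimately show ?thesis using True eq unfolding c_def
        by (metis Re_complex_of_real complex_cnj_complex_of_real of_real_1 of_real_mult)
    qed
    finally show "(cadj U * U) $$ (i,j) = 1\<^sub>m n $$ (i,j)" using ij by simp
  qed (use dimU in auto)
  then have "unitary n U" using dimU by (intro unitaryI)
  moreover have "col U 0 = c 0 \<cdot>\<^sub>v v" using colU[of 0] n ws0 by simp
  ultimately show ?thesis by blast
qed

text \<open>Deflation. In an orthonormal basis starting with an eigenvector, a Hermitian matrix is
  block diagonal with a real 1 by 1 block; the induction hypothesis diagonalises the other
  block.\<close>

theorem hermitian_spectral:
  assumes "hermitian A" "dim_row A = n"
  shows "\<exists>U d. unitary n U \<and> A = U * rdiag n d * cadj U"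
  using assms
proof (induction n arbitrary: A)
  case 0
  have "unitary 0 (1\<^sub>m 0)" by (rule unitaryI) auto
  moreover have "A = 1\<^sub>m 0 * rdiag 0 (\<lambda>_. 0) * cadj (1\<^sub>m 0)"
    using 0 hermitianD[OF 0(1)] by (intro eq_matI) auto
  ultimately show ?case by blast
next
  case (Suc n)
  let ?J = "inj_left (Suc 0) n" and ?K = "inj_right (Suc 0) n"
  note A = Suc.prems hermitianD[OF Suc.prems(1)]
  have Ac: "A \<in> carrier_mat (Suc n) (Suc n)" using A by auto
  obtain e where "e \<in> spectrum A" using spectrum_non_empty[OF Ac] by auto
  then obtain v where v: "v \<in> carrier_vec (Suc n)" "v \<noteq> 0\<^sub>v (Suc n)" "A *\<^sub>v v = e \<cdot>\<^sub>v v"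
    using A by (auto simp: spectrum_def eigenvalue_def eigenvector_def)
  obtain W c where W: "unitary (Suc n) W" and colW: "col W 0 = c \<cdot>\<^sub>v v"
    using unitary_with_first_col[OF v(1,2)] by blast
  note W' = unitaryD[OF W]
  define B where "B = cadj W * A * W"
  have Bh: "hermitian B" unfolding B_def by (rule hermitian_congruence) (use A W' in auto)
  have Bd: "dim_row B = Suc n" "dim_col B = Suc n" "cadj B = B"
    using hermitianD[OF Bh] W' by (auto simp: B_def)
  \<comment> \<open>\<open>W * ?J\<close> is the first column of \<open>W\<close>, a multiple of the
    eigenvector \<open>v\<close>.\<close>
  have "A * (W * ?J) = e \<cdot>\<^sub>m (W * ?J)"
  proof (rule eq_matI)
    fix i j assume "i < dim_row (e \<cdot>\<^sub>m (W * ?J))" "j < dim_col (e \<cdot>\<^sub>m (W * ?J))"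
    then have ij: "i < Suc n" "j = 0" using W' by auto
    have "col ?J 0 = unit_vec (Suc n) 0"
      by (rule eq_vecI) (auto simp: inj_left_def)
    moreover have "W *\<^sub>v unit_vec (Suc n) 0 = col W 0"
      by (rule eq_vecI) (use W' in auto)
    ultimately have colWJ: "col (W * ?J) 0 = c \<cdot>\<^sub>v v"
      using W' colW by (subst col_mult2[of _ "Suc n" "Suc n" _ 1]) auto
    then have "(A * (W * ?J)) $$ (i,j) = (A *\<^sub>v (c \<cdot>\<^sub>v v)) $ i"
      using ij A W' by simp
    also have "\<dots> = (e \<cdot>\<^sub>v (c \<cdot>\<^sub>v v)) $ i"
      using v A ij Ac by (simp add: mult_mat_vec[OF Ac v(1)] mult_ac)
    also have "\<dots> = e * col (W * ?J) 0 $ i" using colWJ ij v by simp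
    also have "\<dots> = (e \<cdot>\<^sub>m (W * ?J)) $$ (i,j)" using ij W' by simp
    finally show "(A * (W * ?J)) $$ (i,j) = (e \<cdot>\<^sub>m (W * ?J)) $$ (i,j)" .
  qed (use A W' in auto)
  then have BJ: "B * ?J = e \<cdot>\<^sub>m ?J"
    unfolding B_def using A W' mat_cancel_left[OF W'(4)] by (simp add: mat_dim_simps)
  \<comment> \<open>The corner entry of the Hermitian matrix \<open>B\<close> is \<open>e\<close>;
    comparing it with its adjoint shows that \<open>e\<close> is real.\<close>
  have "cadj ?J * (B * ?J) = e \<cdot>\<^sub>m 1\<^sub>m (Suc 0)" unfolding BJ by (simp add: mat_dim_simps inj_isometry)
  moreover have "cadj (cadj ?J * (B * ?J)) = cadj ?J * (B * ?J)"
    using Bd by (simp add: cadj_mult mat_mult_assoc_dim)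
  ultimately have "cnj e \<cdot>\<^sub>m 1\<^sub>m (Suc 0) = e \<cdot>\<^sub>m 1\<^sub>m (Suc 0)" by (simp add: cadj_smult)
  then have "(cnj e \<cdot>\<^sub>m 1\<^sub>m (Suc 0)) $$ (0,0) = (e \<cdot>\<^sub>m 1\<^sub>m (Suc 0)) $$ (0,0)" by simp
  then have "cnj e = e" by simp
  then obtain r where r: "e = complex_of_real r" by (metis Reals_cnj_iff Reals_cases)
  \<comment> \<open>Since \<open>e\<close> is real, the adjoint of \<open>BJ\<close> says the same
    about the first row, so both off-diagonal blocks of \<open>B\<close> vanish.\<close>
  have JB: "cadj ?J * B = e \<cdot>\<^sub>m cadj ?J"
    using arg_cong[OF BJ, of cadj] Bd by (simp add: cadj_mult cadj_smult \<open>cnj e = e\<close>)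
  define B' where "B' = cadj ?K * B * ?K"
  have "hermitian B'" unfolding B'_def by (rule hermitian_congruence) (use Bh Bd in auto)
  moreover have "dim_row B' = n" by (simp add: B'_def)
  ultimately obtain U d where U: "unitary n U" and B'U: "B' = U * rdiag n d * cadj U"
    using Suc.IH by blast
  note U' = unitaryD[OF U]
  \<comment> \<open>The block matrix with diagonal blocks 1 and \<open>U\<close>.\<close>
  define V where "V = ?J * cadj ?J + ?K * U * cadj ?K"
  have Vd: "dim_row V = Suc n" "dim_col V = Suc n" by (auto simp: V_def)
  have cV: "cadj V = ?J * cadj ?J + ?K * cadj U * cadj ?K"
    unfolding V_def using U' by (simp add: cadj_add cadj_mult mat_mult_assoc_dim)
  note cancel = inj_cancel mat_cancel_left[OF U'(3)] mat_cancel_left[OF U'(4)]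
  have "cadj V * V = ?J * cadj ?J + ?K * cadj ?K"
    unfolding cV unfolding V_def using U' by (simp add: mat_dim_simps cancel)
  then have V: "unitary (Suc n) V" using Vd by (intro unitaryI) (simp_all add: inj_complete)
  have "B = (?J * cadj ?J + ?K * cadj ?K) * B * (?J * cadj ?J + ?K * cadj ?K)"
    using Bd by (simp add: inj_complete mat_dim_simps)
  also have "\<dots> = e \<cdot>\<^sub>m (?J * cadj ?J) + ?K * B' * cadj ?K"
  proof -
    have 1: "B * (?J * M) = e \<cdot>\<^sub>m (?J * M)" if "dim_row M = Suc 0" for M
      using that Bd by (simp flip: mat_mult_assoc_dim add: BJ mat_smult_mult_dim)
    have 2: "cadj ?J * (B * M) = e \<cdot>\<^sub>m (cadj ?J * M)" if "dim_row M = Suc n" for M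
      using that Bd by (simp flip: mat_mult_assoc_dim add: JB mat_smult_mult_dim)
    show ?thesis unfolding B'_def using Bd by (simp add: mat_dim_simps cancel 1 2)
  qed
  \<comment> \<open>\<open>case_nat r d\<close> puts \<open>r\<close> at index 0 and shifts the
    eigenvalues \<open>d\<close> of \<open>B'\<close> up by one.\<close>
  also have "\<dots> = V * rdiag (Suc 0 + n) (case_nat r d) * cadj V"
  proof -
    have 1: "rdiag (Suc 0) (case_nat r d) = e \<cdot>\<^sub>m 1\<^sub>m (Suc 0)" unfolding r by (rule eq_matI) (auto simp: rdiag_def)
    have 2: "rdiag (Suc 0 + n) (case_nat r d) = e \<cdot>\<^sub>m (?J * cadj ?J) + ?K * rdiag n d * cadj ?K"
      unfolding rdiag_split 1 by (simp add: mat_dim_simps)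
    show ?thesis unfolding 2 cV B'U unfolding V_def using U'
      by (simp add: mat_dim_simps cancel)
  qed
  finally have B: "B = V * rdiag (Suc n) (case_nat r d) * cadj V" by simp
  have "W * B * cadj W = A"
    unfolding B_def using A W' mat_cancel_left[OF W'(3)] by (simp add: mat_dim_simps)
  then have "A = (W * V) * rdiag (Suc n) (case_nat r d) * cadj (W * V)"
    unfolding B using W' Vd by (simp add: mat_dim_simps cadj_mult)
  moreover have "unitary (Suc n) (W * V)"
    by (rule unitaryI)
       (use W' Vd unitaryD[OF V] mat_cancel_left[OF W'(4)] in \<open>auto simp: mat_dim_simps cadj_mult\<close>)
  ultimately show ?case by blast
qed

section \<open>Functional calculus\<close>

text \<open>For \<open>M = cadj U * V * W\<close> the hypothesis reads \<open>d i = e j\<close> or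
  \<open>M $$ (i,j) = 0\<close> for each entry. This is preserved by applying an arbitrary
  \<open>f\<close> to both diagonals, whatever the shape or rank of \<open>V\<close>.\<close>

lemma diag_intertwine:
  assumes U: "unitary n U" and W: "unitary m W" and V: "dim_row V = n" "dim_col V = m"
    and eq: "(U * rdiag n d * cadj U) * V = V * (W * rdiag m e * cadj W)"
  shows "(U * rdiag n (\<lambda>i. f (d i)) * cadj U) * V = V * (W * rdiag m (\<lambda>i. f (e i)) * cadj W)"
proof -
  note U' = unitaryD[OF U] and W' = unitaryD[OF W]
  note cancel = mat_cancel_left[OF U'(3)] mat_cancel_left[OF U'(4)]
    mat_cancel_left[OF W'(3)] mat_cancel_left[OF W'(4)]
  define M where "M = cadj U * V * W"
  have Md: "dim_row M = n" "dim_col M = m" using U' W' by (auto simp: M_def)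
  have "rdiag n d * M = cadj U * ((U * rdiag n d * cadj U) * V) * W"
    unfolding M_def using U' W' V by (simp add: mat_dim_simps cancel)
  also have "\<dots> = M * rdiag m e"
    unfolding eq M_def using U' W' V by (simp add: mat_dim_simps cancel)
  finally have DM: "rdiag n d * M = M * rdiag m e" .
  have "rdiag n (\<lambda>i. f (d i)) * M = M * rdiag m (\<lambda>i. f (e i))"
  proof (rule eq_matI)
    fix i j assume "i < dim_row (M * rdiag m (\<lambda>i. f (e i)))" "j < dim_col (M * rdiag m (\<lambda>i. f (e i)))"
    then have ij: "i < n" "j < m" using Md by auto
    have "(rdiag n d * M) $$ (i,j) = (M * rdiag m e) $$ (i,j)" using DM by simp
    then have "d i = e j \<or> M $$ (i,j) = 0"
      using ij Md by (auto simp: rdiag_mult_index mult_rdiag_index simp del: index_mult_mat(1))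
    then show "(rdiag n (\<lambda>i. f (d i)) * M) $$ (i,j) = (M * rdiag m (\<lambda>i. f (e i))) $$ (i,j)"
      using ij Md by (auto simp: rdiag_mult_index mult_rdiag_index simp del: index_mult_mat(1))
  qed (use Md in auto)
  then have "U * (rdiag n (\<lambda>i. f (d i)) * M) * cadj W = U * (M * rdiag m (\<lambda>i. f (e i))) * cadj W"
    by simp
  then show ?thesis unfolding M_def using U' W' V by (simp add: mat_dim_simps cancel)
qed

text \<open>The choice in \<open>matfun\<close> is harmless: two diagonalisations of the same matrix
  are intertwined by the identity, so \<open>diag_intertwine\<close> shows that they yield the same
  value.\<close>

lemma matfun_unitary_diag:
  assumes U: "unitary n U" and A: "A = U * rdiag n d * cadj U"
  shows "matfun f A = U * rdiag n (\<lambda>i. f (d i)) * cadj U"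
proof -
  note U' = unitaryD[OF U]
  have n: "dim_row A = n" "dim_col A = n" using A U' by auto
  let ?P = "\<lambda>B. \<exists>U d. unitary (dim_row A) U \<and> A = U * rdiag (dim_row A) d * cadj U \<and>
       B = U * rdiag (dim_row A) (\<lambda>i. f (d i)) * cadj U"
  have "?P (U * rdiag n (\<lambda>i. f (d i)) * cadj U)" using U A unfolding n(1) by blast
  then have "?P (matfun f A)" unfolding matfun_def by (rule someI)
  then obtain W e where W: "unitary n W" "A = W * rdiag n e * cadj W"
      and m: "matfun f A = W * rdiag n (\<lambda>i. f (e i)) * cadj W" unfolding n(1) by blast
  note W' = unitaryD[OF W(1)]
  have "(U * rdiag n d * cadj U) * 1\<^sub>m n = 1\<^sub>m n * (W * rdiag n e * cadj W)"
    unfolding A[symmetric] W(2)[symmetric] using n W' by (subst W(2)) (simp add: mat_left_one_dim mat_right_one_dim flip: W(2))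
  from diag_intertwine[OF U W(1) _ _ this, of f] show ?thesis
    unfolding m using U' W' by (simp add: mat_left_one_dim mat_right_one_dim)
qed

lemma matfun_dim:
  assumes "hermitian A" shows "dim_row (matfun f A) = dim_row A" "dim_col (matfun f A) = dim_row A"
proof -
  obtain U d where U: "unitary (dim_row A) U" "A = U * rdiag (dim_row A) d * cadj U"
    using hermitian_spectral[OF assms refl] by blast
  show "dim_row (matfun f A) = dim_row A" "dim_col (matfun f A) = dim_row A"
    unfolding matfun_unitary_diag[OF U, of f] using unitaryD[OF U(1)] by auto
qed

text \<open>The main tool for moving a function past a factor. It is applied below with
  \<open>V\<close> an isometry (compression), a block embedding, a unitary matrix, and a factor
  \<open>S * R\<close> of \<open>B\<close>.\<close>

theorem matfun_intertwine:
  assumes "hermitian A" "hermitian B" "dim_row V = dim_row A" "dim_col V = dim_row B" "A * V = V * B"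
  shows "matfun f A * V = V * matfun f B"
proof -
  obtain U d where U: "unitary (dim_row A) U" "A = U * rdiag (dim_row A) d * cadj U"
    using hermitian_spectral[OF assms(1) refl] by blast
  obtain W e where W: "unitary (dim_row B) W" "B = W * rdiag (dim_row B) e * cadj W"
    using hermitian_spectral[OF assms(2) refl] by blast
  show ?thesis
    unfolding matfun_unitary_diag[OF U, of f] matfun_unitary_diag[OF W, of f]
    by (rule diag_intertwine[OF U(1) W(1) assms(3,4)]) (use assms(5) in \<open>simp flip: U(2) W(2)\<close>)
qed

lemma hermitian_unitary_diag: "unitary n U \<Longrightarrow> hermitian (U * rdiag n d * cadj U)"
  using hermitian_congruence[of "rdiag n d" "cadj U"] unitaryD[of n U] by (simp add: hermitian_iff)

lemma hermitian_matfun: assumes "hermitian A" shows "hermitian (matfun f A)"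
proof -
  obtain U d where U: "unitary (dim_row A) U" "A = U * rdiag (dim_row A) d * cadj U"
    using hermitian_spectral[OF assms refl] by blast
  show ?thesis
    unfolding matfun_unitary_diag[OF U, of f] by (rule hermitian_unitary_diag[OF U(1)])
qed

lemma matfun_mult:
  assumes "hermitian A"
  shows "matfun f A * matfun g A = matfun (\<lambda>x. f x * g x) A"
proof -
  obtain U d where U: "unitary (dim_row A) U" "A = U * rdiag (dim_row A) d * cadj U"
    using hermitian_spectral[OF assms refl] by blast
  note U' = unitaryD[OF U(1)]
  have "rdiag n p * (rdiag n q * M) = rdiag n (\<lambda>i. p i * q i) * M" if "dim_row M = n" for n p q M
    using that by (simp flip: mat_mult_assoc_dim add: rdiag_mult)
  then show ?thesis
    unfolding matfun_unitary_diag[OF U] using U' mat_cancel_left[OF U'(4)] by (simp add: mat_dim_simps)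
qed

lemma matfun_compose:
  assumes "hermitian A"
  shows "matfun f (matfun g A) = matfun (\<lambda>x. f (g x)) A"
proof -
  obtain U d where U: "unitary (dim_row A) U" "A = U * rdiag (dim_row A) d * cadj U"
    using hermitian_spectral[OF assms refl] by blast
  show ?thesis
    unfolding matfun_unitary_diag[OF U] matfun_unitary_diag[OF U(1) refl] by simp
qed

lemma matfun_const:
  assumes "hermitian A"
  shows "matfun (\<lambda>x. c) A = complex_of_real c \<cdot>\<^sub>m 1\<^sub>m (dim_row A)"
proof -
  obtain U d where U: "unitary (dim_row A) U" "A = U * rdiag (dim_row A) d * cadj U"
    using hermitian_spectral[OF assms refl] by blast
  have "rdiag (dim_row A) (\<lambda>i. c) = complex_of_real c \<cdot>\<^sub>m 1\<^sub>m (dim_row A)"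
    by (rule eq_matI) (auto simp: rdiag_def)
  then show ?thesis
    unfolding matfun_unitary_diag[OF U] using unitaryD[OF U(1)] by (simp add: mat_dim_simps)
qed

lemma matfun_ident:
  assumes "hermitian A" shows "matfun (\<lambda>x. x) A = A"
proof -
  obtain U d where U: "unitary (dim_row A) U" "A = U * rdiag (dim_row A) d * cadj U"
    using hermitian_spectral[OF assms refl] by blast
  show ?thesis by (subst matfun_unitary_diag[OF U]) (rule U(2)[symmetric])
qed

text \<open>The scaled matrix is itself a function of \<open>A\<close>, so the composition rule
  applies.\<close>

lemma matfun_smult:
  assumes "hermitian A"
  shows "matfun f (complex_of_real c \<cdot>\<^sub>m A) = matfun (\<lambda>x. f (c * x)) A"
proof -
  have "complex_of_real c \<cdot>\<^sub>m A = matfun (\<lambda>x. c) A * matfun (\<lambda>x. x) A"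
    using assms hermitianD[OF assms] by (simp add: matfun_const matfun_ident mat_dim_simps)
  then show ?thesis using assms by (simp add: matfun_mult matfun_compose)
qed

section \<open>Positivity and order under the functional calculus\<close>

text \<open>In eigenbasis coordinates the form is a combination of the eigenvalues with nonnegative
  weights, which reduces order statements about functions of one matrix to scalar ones.\<close>

lemma qform_unitary_diag:
  assumes U: "unitary n U" and v: "dim_vec v = n"
  shows "qform (U * rdiag n d * cadj U) v = (\<Sum>i<n. d i * (cmod ((cadj U *\<^sub>v v) $ i))\<^sup>2)"
proof -
  note U' = unitaryD[OF U]
  define w where "w = cadj U *\<^sub>v v"
  have w: "dim_vec w = n" using U' by (simp add: w_def)
  have "qform (U * rdiag n d * cadj U) v = qform (rdiag n d) w"
    using qform_congruence[of "cadj U" "rdiag n d" v] U' v by (simp add: w_def)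
  also have "\<dots> = Re (\<Sum>i<n. \<Sum>j<n. cnj (w $ i) * rdiag n d $$ (i,j) * w $ j)"
    using w by (simp only: qform_sum rdiag_dim)
  also have "\<dots> = Re (\<Sum>i<n. \<Sum>j<n. if j = i then cnj (w $ i) * d i * w $ i else 0)"
    by (intro arg_cong[of _ _ Re] sum.cong) (auto simp: rdiag_def)
  also have "\<dots> = Re (\<Sum>i<n. cnj (w $ i) * d i * w $ i)"
    by (intro arg_cong[of _ _ Re] sum.cong) auto
  also have "\<dots> = Re (\<Sum>i<n. complex_of_real (d i * (cmod (w $ i))\<^sup>2))"
    by (simp only: of_real_mult complex_norm_square mult_ac)
  finally show ?thesis by (simp add: w_def)
qed

text \<open>The witness is column \<open>i\<close> of \<open>U\<close>, the same for every diagonal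
  \<open>d\<close>. It serves to read the sign of an eigenvalue off the positivity of the
  form.\<close>

lemma qform_unitary_diag_eigenvector:
  assumes U: "unitary n U" and i: "i < n"
  shows "\<exists>v. dim_vec v = n \<and> v \<noteq> 0\<^sub>v n \<and> (\<forall>d. qform (U * rdiag n d * cadj U) v = d i)"
proof (intro exI conjI allI)
  note U' = unitaryD[OF U]
  define v where "v = U *\<^sub>v unit_vec n i"
  show v: "dim_vec v = n" using U' by (simp add: v_def)
  have Uv: "cadj U *\<^sub>v v = unit_vec n i"
    unfolding v_def using U' by (simp flip: mat_mult_vec_assoc_dim)
  show "v \<noteq> 0\<^sub>v n"
  proof
    assume "v = 0\<^sub>v n"
    then have "cadj U *\<^sub>v v = 0\<^sub>v n" using U' by (intro eq_vecI) (auto simp: scalar_prod_def)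
    then show False using Uv i by (metis unit_vec_nonzero)
  qed
  fix d
  have "qform (U * rdiag n d * cadj U) v = (\<Sum>j<n. if j = i then d i else 0)"
    unfolding qform_unitary_diag[OF U v] Uv by (rule sum.cong) (use i in auto)
  also have "\<dots> = d i" using i by simp
  finally show "qform (U * rdiag n d * cadj U) v = d i" .
qed

lemma pd_spectral:
  assumes "pd n A"
  shows "\<exists>U d. unitary n U \<and> A = U * rdiag n d * cadj U \<and> (\<forall>i<n. d i > 0)"
proof -
  obtain U d where U: "unitary n U" "A = U * rdiag n d * cadj U"
    using hermitian_spectral[of A n] pdD[OF assms] by blast
  have "d i > 0" if "i < n" for i
    using qform_unitary_diag_eigenvector[OF U(1) that] assms unfolding pd_iff U(2) by metis
  then show ?thesis using U by blast
qed

text \<open>Supplies the second block \<open>E\<close> that completes a contraction to an isometry.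
  Any factor will do; here it is the root of the diagonal part times \<open>cadj U\<close>.\<close>

lemma psd_sqrt:
  assumes "psd A" "dim_row A = n"
  shows "\<exists>E. dim_row E = n \<and> dim_col E = n \<and> cadj E * E = A"
proof -
  have h: "hermitian A" using assms by (simp add: psd_iff)
  obtain U d where U: "unitary n U" "A = U * rdiag n d * cadj U"
    using hermitian_spectral[of A n] h assms by blast
  note U' = unitaryD[OF U(1)]
  have pos: "d i \<ge> 0" if "i < n" for i
    using qform_unitary_diag_eigenvector[OF U(1) that] assms unfolding psd_iff by (metis U(2))
  define E where "E = rdiag n (\<lambda>i. sqrt (d i)) * cadj U"
  have "rdiag n (\<lambda>i. sqrt (d i)) * rdiag n (\<lambda>i. sqrt (d i)) = rdiag n d"
    unfolding rdiag_mult by (rule eq_matI) (use pos in \<open>auto simp: rdiag_def simp flip: of_real_mult\<close>)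
  then have "cadj E * E = U * rdiag n d * cadj U"
    unfolding E_def using U' by (simp add: cadj_mult mat_mult_assoc_dim)
       (simp flip: mat_mult_assoc_dim)
  then show ?thesis using U U' by (intro exI[of _ E]) (auto simp: E_def)
qed

text \<open>Both sides are functions of the same matrix, so comparing them on its eigenvalues, which
  are positive, is enough; neither function has to be monotone.\<close>

lemma loewner_le_matfun:
  assumes "pd n A" "\<And>x. x > 0 \<Longrightarrow> f x \<le> g x"
  shows "loewner_le (matfun f A) (matfun g A)"
proof -
  obtain U d where U: "unitary n U" "A = U * rdiag n d * cadj U" "\<forall>i<n. d i > 0"
    using pd_spectral[OF assms(1)] by blast
  note A = pdD[OF assms(1)]
  have "qform (matfun f A) v \<le> qform (matfun g A) v" if v: "dim_vec v = n" for v
    unfolding matfun_unitary_diag[OF U(1,2)] qform_unitary_diag[OF U(1) v]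
    by (intro sum_mono mult_right_mono) (use assms U in auto)
  then show ?thesis using A by (simp add: loewner_le_iff hermitian_matfun matfun_dim)
qed

lemma matfun_cong:
  assumes "pd n A" "\<And>x. x > 0 \<Longrightarrow> f x = g x"
  shows "matfun f A = matfun g A"
proof -
  obtain U d where U: "unitary n U" "A = U * rdiag n d * cadj U" "\<forall>i<n. d i > 0"
    using pd_spectral[OF assms(1)] by blast
  have "rdiag n (\<lambda>i. f (d i)) = rdiag n (\<lambda>i. g (d i))"
    by (rule eq_matI) (use U assms in \<open>auto simp: rdiag_def\<close>)
  then show ?thesis unfolding matfun_unitary_diag[OF U(1,2)] by simp
qed

text \<open>The smallest eigenvalue gives a uniform margin, used later to absorb small
  perturbations.\<close>

lemma pd_lower_bound:
  assumes "pd n A"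
  shows "\<exists>m>0. loewner_le (complex_of_real m \<cdot>\<^sub>m 1\<^sub>m n) A"
proof -
  obtain U d where U: "unitary n U" "A = U * rdiag n d * cadj U" "\<forall>i<n. d i > 0"
    using pd_spectral[OF assms] by blast
  note A = pdD[OF assms]
  \<comment> \<open>The inserted 1 keeps the minimum over a nonempty set when \<open>n\<close> is
    0.\<close>
  define m where "m = Min (insert 1 (d ` {..<n}))"
  have m: "m > 0" "\<And>i. i < n \<Longrightarrow> m \<le> d i" using U by (auto simp: m_def)
  have "qform (complex_of_real m \<cdot>\<^sub>m 1\<^sub>m n) v \<le> qform A v" if v: "dim_vec v = n" for v
  proof -
    have "complex_of_real m \<cdot>\<^sub>m 1\<^sub>m n = U * rdiag n (\<lambda>i. m) * cadj U"
      using matfun_const[OF A(3), of m] matfun_unitary_diag[OF U(1,2), of "\<lambda>_. m"] A(1) by simp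
    then have "qform (complex_of_real m \<cdot>\<^sub>m 1\<^sub>m n) v = (\<Sum>i<n. m * (cmod ((cadj U *\<^sub>v v) $ i))\<^sup>2)"
      using qform_unitary_diag[OF U(1) v] by simp
    also have "\<dots> \<le> (\<Sum>i<n. d i * (cmod ((cadj U *\<^sub>v v) $ i))\<^sup>2)"
      by (intro sum_mono mult_right_mono) (use m in auto)
    also have "\<dots> = qform A v" unfolding U(2) qform_unitary_diag[OF U(1) v] ..
    finally show ?thesis .
  qed
  then have "loewner_le (complex_of_real m \<cdot>\<^sub>m 1\<^sub>m n) A"
    using A by (simp add: loewner_le_iff hermitian_one hermitian_smult)
  then show ?thesis using m by blast
qed

text \<open>\<open>cadj U\<close> is injective, so a nonzero \<open>v\<close> has a nonzero
  coordinate in the eigenbasis; its term is positive and the others are nonnegative.\<close>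

lemma pd_matfun:
  assumes "pd n A" "\<And>x. x > 0 \<Longrightarrow> f x > 0"
  shows "pd n (matfun f A)"
proof -
  obtain U d where U: "unitary n U" "A = U * rdiag n d * cadj U" "\<forall>i<n. d i > 0"
    using pd_spectral[OF assms(1)] by blast
  note A = pdD[OF assms(1)] and U' = unitaryD[OF U(1)]
  have "0 < qform (matfun f A) v" if v: "dim_vec v = n" "v \<noteq> 0\<^sub>v n" for v
  proof -
    let ?w = "cadj U *\<^sub>v v"
    have "?w \<noteq> 0\<^sub>v n"
    proof
      assume "?w = 0\<^sub>v n"
      then have "U *\<^sub>v ?w = 0\<^sub>v n" using U' by (intro eq_vecI) (auto simp: scalar_prod_def)
      moreover have "U *\<^sub>v ?w = v"
        using U' v carrier_vecI[of v n] by (simp flip: mat_mult_vec_assoc_dim)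
      ultimately show False using v by simp
    qed
    then obtain i where i: "i < n" "?w $ i \<noteq> 0"
      using U' by (metis cadj_dim(1) dim_mult_mat_vec eq_vecI index_zero_vec)
    have "0 < f (d i) * (cmod (?w $ i))\<^sup>2" using i U assms by simp
    also have "\<dots> \<le> (\<Sum>i<n. f (d i) * (cmod (?w $ i))\<^sup>2)"
      by (rule member_le_sum[where f = "\<lambda>i. f (d i) * (cmod (?w $ i))\<^sup>2"])
         (use i U assms in \<open>auto simp: less_imp_le\<close>)
    finally show ?thesis
      unfolding matfun_unitary_diag[OF U(1,2)] qform_unitary_diag[OF U(1) v(1)] .
  qed
  then show ?thesis using A by (simp add: pd_iff hermitian_matfun matfun_dim)
qed

text \<open>Links positive definiteness to the spectral condition in
  \<open>matrix_monotone_on\<close>: written in the eigenbasis, an eigenvector has a nonzero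
  coordinate \<open>i\<close>, and comparing that coordinate gives \<open>k = d i\<close>.\<close>

lemma pd_spec_in:
  assumes "pd n A" shows "spec_in {0..} A"
  unfolding spec_in_def
proof (intro allI impI)
  fix k assume "eigenvalue A k"
  then obtain v where v: "v \<in> carrier_vec n" "v \<noteq> 0\<^sub>v n" "A *\<^sub>v v = k \<cdot>\<^sub>v v"
    using pdD[OF assms] by (auto simp: eigenvalue_def eigenvector_def)
  obtain U d where U: "unitary n U" "A = U * rdiag n d * cadj U" "\<forall>i<n. d i > 0"
    using pd_spectral[OF assms] by blast
  note U' = unitaryD[OF U(1)]
  define w where "w = cadj U *\<^sub>v v"
  have Uw: "U *\<^sub>v w = v"
    unfolding w_def using U' v by (simp flip: mat_mult_vec_assoc_dim)
  have "w \<noteq> 0\<^sub>v n"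
  proof
    assume "w = 0\<^sub>v n"
    then have "U *\<^sub>v w = 0\<^sub>v n" using U' by (intro eq_vecI) (auto simp: scalar_prod_def)
    then show False using v Uw by simp
  qed
  then obtain i where i: "i < n" "w $ i \<noteq> 0"
    using U' unfolding w_def by (metis cadj_dim(1) dim_mult_mat_vec eq_vecI index_zero_vec)
  have wd: "w \<in> carrier_vec n" using U' by (auto simp: w_def intro: carrier_vecI)
  have "rdiag n d *\<^sub>v w = cadj U *\<^sub>v (A *\<^sub>v v)"
    unfolding U(2) w_def using U' v mat_cancel_left[OF U'(4)]
    by (simp flip: mat_mult_vec_assoc_dim add: mat_mult_assoc_dim)
  also have "\<dots> = k \<cdot>\<^sub>v w"
    unfolding v(3) w_def using U' v by (intro mult_mat_vec[of _ n n]) auto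
  finally have "(rdiag n d *\<^sub>v w) $ i = k * w $ i" using i wd by simp
  moreover have "(rdiag n d *\<^sub>v w) $ i = d i * w $ i"
  proof -
    have "(rdiag n d *\<^sub>v w) $ i = (\<Sum>j\<in>{0..<n}. (if i = j then complex_of_real (d i) else 0) * w $ j)"
      using i wd by (simp add: scalar_prod_def rdiag_def)
    also have "\<dots> = (\<Sum>j\<in>{0..<n}. if j = i then d i * w $ i else 0)"
      by (rule sum.cong) auto
    finally show ?thesis using i by simp
  qed
  ultimately have "k = d i" using i by simp
  then show "k \<in> complex_of_real ` {0..}" using U(3) i by (auto intro: less_imp_le)
qed

text \<open>The form in which monotonicity is used throughout: between positive definite matrices,
  where only values at positive reals occur.\<close>

lemma matrix_monotone_on_pd:
  assumes "matrix_monotone_on {0..} h" "pd n X" "loewner_le X Y"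
  shows "loewner_le (matfun h X) (matfun h Y)"
  using assms pd_loewner_le[OF assms(2,3)] pd_spec_in pdD(3) unfolding matrix_monotone_on_def by blast

section \<open>Hansen's inequality\<close>

lemma matfun_cmult:
  assumes "hermitian A"
  shows "matfun (\<lambda>x. c * f x) A = complex_of_real c \<cdot>\<^sub>m matfun f A"
proof -
  have "matfun (\<lambda>x. c * f x) A = matfun (\<lambda>x. c) A * matfun f A"
    using assms by (simp add: matfun_mult)
  then show ?thesis using matfun_dim[OF assms, of f] by (simp add: matfun_const[OF assms] mat_dim_simps)
qed

lemma matfun_scalar:
  "matfun f (complex_of_real c \<cdot>\<^sub>m 1\<^sub>m n) = complex_of_real (f c) \<cdot>\<^sub>m 1\<^sub>m n"
  using matfun_const[OF hermitian_one, of c n] matfun_const[OF hermitian_one, of "f c" n]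
    matfun_compose[OF hermitian_one, of f "\<lambda>_. c" n] by simp

text \<open>Together with \<open>matfun_scalar\<close> this lets 1 by 1 matrices stand for real
  numbers, so that matrix inequalities specialise to scalar ones.\<close>

lemma loewner_le_scalar:
  "loewner_le (complex_of_real a \<cdot>\<^sub>m 1\<^sub>m 1) (complex_of_real b \<cdot>\<^sub>m 1\<^sub>m 1) \<longleftrightarrow> a \<le> b"
proof
  assume le: "loewner_le (complex_of_real a \<cdot>\<^sub>m 1\<^sub>m 1) (complex_of_real b \<cdot>\<^sub>m 1\<^sub>m 1)"
  define v :: "complex vec" where "v = unit_vec 1 0"
  have v: "dim_vec v = 1" "v \<noteq> 0\<^sub>v 1" unfolding v_def by (simp, rule unit_vec_nonzero, simp)
  have "a * qform (1\<^sub>m 1) v \<le> b * qform (1\<^sub>m 1) v"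
    using le v by (simp add: loewner_le_iff qform_smult[of _ 1])
  then show "a \<le> b" using qform_one_pos[OF v] by (simp add: mult_le_cancel_right)
next
  assume "a \<le> b"
  then show "loewner_le (complex_of_real a \<cdot>\<^sub>m 1\<^sub>m 1) (complex_of_real b \<cdot>\<^sub>m 1\<^sub>m 1)"
    by (simp add: loewner_le_iff hermitian_smult hermitian_one qform_smult[of _ 1] mult_right_mono
        qform_one_nonneg del: One_nat_def)
qed

text \<open>A weighted arithmetic-geometric estimate of the cross terms
  \<open>P * X * Q + Q * X * P\<close>. The factor on the \<open>P\<close> part can be brought as
  close to 1 as desired; the large factor falls on the \<open>Q\<close> part, which the compression
  below annihilates.\<close>

lemma pinching_bound:
  fixes V :: "complex mat"
  assumes X: "pd N X" and V: "dim_row V = N" and e: "e > 0"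
  defines "P \<equiv> V * cadj V"
  defines "Q \<equiv> 1\<^sub>m N - P"
  shows "loewner_le X (complex_of_real (1 + e) \<cdot>\<^sub>m (P * X * P) + complex_of_real (1 + 1 / e) \<cdot>\<^sub>m (Q * X * Q))"
    (is "loewner_le X ?Z")
proof -
  note X' = pdD[OF X]
  have P: "dim_row P = N" "dim_col P = N" "cadj P = P"
    unfolding P_def using V by (auto simp: cadj_mult)
  have Q: "dim_row Q = N" "dim_col Q = N" "cadj Q = Q"
    unfolding Q_def using P by (auto simp: cadj_minus)
  have PXP: "hermitian (P * X * P)" using hermitian_congruence[OF X'(3), of P] P X' by simp
  have QXQ: "hermitian (Q * X * Q)" using hermitian_congruence[OF X'(3), of Q] Q X' by simp
  have Z: "hermitian ?Z" by (intro hermitian_add hermitian_smult PXP QXQ) (use P Q in simp)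
  \<comment> \<open>\<open>?Z - X\<close> is the congruence of \<open>X\<close> by this \<open>S\<close>.\<close>
  define S where "S = complex_of_real (sqrt e) \<cdot>\<^sub>m P - complex_of_real (1 / sqrt e) \<cdot>\<^sub>m Q"
  have S: "dim_row S = N" "dim_col S = N" "cadj S = S"
    unfolding S_def using P Q by (auto simp: cadj_minus cadj_smult)
  have PQ: "P + Q = 1\<^sub>m N" unfolding Q_def using P by (intro eq_matI) auto
  have "X = (P + Q) * X * (P + Q)" unfolding PQ using X' by (simp add: mat_dim_simps)
  also have "\<dots> = P * X * P + P * X * Q + (Q * X * P + Q * X * Q)"
    using P Q X' by (intro eq_matI) (simp_all add: mat_dim_simps del: index_mult_mat(1))
  finally have Xexp: "X = P * X * P + P * X * Q + (Q * X * P + Q * X * Q)" .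
  have s: "complex_of_real (sqrt e) * complex_of_real (sqrt e) = complex_of_real e"
    "complex_of_real (sqrt e) * complex_of_real (1 / sqrt e) = 1"
    "complex_of_real (1 / sqrt e) * complex_of_real (sqrt e) = 1"
    "complex_of_real (1 / sqrt e) * complex_of_real (1 / sqrt e) = complex_of_real (1 / e)"
    using e by (simp_all flip: of_real_mult)
  have s': "complex_of_real (sqrt e) * (complex_of_real (sqrt e) * z) = complex_of_real e * z"
    "complex_of_real (sqrt e) * (complex_of_real (1 / sqrt e) * z) = z"
    "complex_of_real (1 / sqrt e) * (complex_of_real (sqrt e) * z) = z"
    "complex_of_real (1 / sqrt e) * (complex_of_real (1 / sqrt e) * z) = complex_of_real (1 / e) * z" for z
    unfolding mult.assoc[symmetric] s by simp_all
  have "S * X * S = complex_of_real e \<cdot>\<^sub>m (P * X * P) + complex_of_real (1 / e) \<cdot>\<^sub>m (Q * X * Q)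
      - (P * X * Q + Q * X * P)"
    unfolding S_def using P Q X'
    by (intro eq_matI) (simp_all add: mat_dim_simps s' algebra_simps del: index_mult_mat(1) of_real_divide)
  then have "?Z = (P * X * P + P * X * Q + (Q * X * P + Q * X * Q)) + S * X * S"
    using P Q X'
    by (intro eq_matI) (simp_all add: algebra_simps del: index_mult_mat(1) of_real_divide)
  then have ZX: "?Z = X + S * X * S" using Xexp by simp
  have "qform X v \<le> qform ?Z v" if v: "dim_vec v = N" for v
  proof -
    have "qform ?Z v = qform X v + qform (S * X * S) v"
      unfolding ZX by (rule qform_add[of _ N]) (use X' S v in auto)
    also have "qform (S * X * S) v = qform X (S *\<^sub>v v)"
      using qform_congruence[of S X v] X' S v by simp
    finally show ?thesis using pd_nonneg[OF X, of "S *\<^sub>v v"] S by simp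
  qed
  then show ?thesis using X' Z Q by (simp add: loewner_le_iff)
qed

text \<open>Replace \<open>X\<close> by the larger pinched matrix \<open>Z\<close>. Since
  \<open>V\<close> is an isometry, \<open>Q * V\<close> vanishes and \<open>Z * V = V * Y\<close>,
  so \<open>matfun h Z\<close> compresses exactly to \<open>matfun h Y\<close>.\<close>

lemma compression_monotone:
  assumes h: "matrix_monotone_on {0..} h" and X: "pd N X"
    and V: "dim_row V = N" "cadj V * V = 1\<^sub>m n" and e: "e > 0"
  shows "loewner_le (cadj V * matfun h X * V) (matfun h (complex_of_real (1 + e) \<cdot>\<^sub>m (cadj V * X * V)))"
proof -
  note X' = pdD[OF X]
  have Vc: "dim_col V = n" using V(2) by (metis index_mult_mat(3) index_one_mat(3))
  define P where "P = V * cadj V"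
  define Q where "Q = 1\<^sub>m N - P"
  define Z where "Z = complex_of_real (1 + e) \<cdot>\<^sub>m (P * X * P) + complex_of_real (1 + 1 / e) \<cdot>\<^sub>m (Q * X * Q)"
  define Y where "Y = complex_of_real (1 + e) \<cdot>\<^sub>m (cadj V * X * V)"
  have XZ: "loewner_le X Z"
    unfolding Z_def P_def Q_def using pinching_bound[OF X V(1) e] .
  have Z: "hermitian Z" "dim_row Z = N" using XZ X' by (auto simp: loewner_le_iff)
  have Y: "hermitian Y" "dim_row Y = n"
    unfolding Y_def by (intro hermitian_smult hermitian_congruence) (use X' V Vc in auto)
  have PV: "P * V = V" unfolding P_def using V Vc by (simp add: mat_dim_simps)
  have P: "dim_row P = N" "dim_col P = N" unfolding P_def using V by auto
  have Q: "dim_row Q = N" "dim_col Q = N" unfolding Q_def using P by auto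
  have "Q * V = 0\<^sub>m N n"
    unfolding Q_def using V Vc P PV by (intro eq_matI) (simp_all add: mat_dim_simps del: index_mult_mat(1))
  then have "Q * (X * (Q * V)) = 0\<^sub>m N n" using X' Q by simp
  moreover have "P * (X * (P * V)) = V * (cadj V * (X * V))"
    unfolding PV unfolding P_def using V Vc X' by (simp add: mat_dim_simps)
  ultimately have "Z * V = V * Y"
    unfolding Z_def Y_def using V Vc P Q X' by (intro eq_matI) (simp_all add: mat_dim_simps del: index_mult_mat(1))
  then have "matfun h Z * V = V * matfun h Y"
    using Z Y V Vc by (intro matfun_intertwine) auto
  then have "cadj V * (matfun h Z * V) = matfun h Y"
    using V Vc Y mat_cancel_left[OF V(2)] by (simp add: matfun_dim)
  moreover have "loewner_le (cadj V * matfun h X * V) (cadj V * matfun h Z * V)"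
    by (intro loewner_le_congruence matrix_monotone_on_pd[OF h X XZ]) (use V X' in \<open>simp add: matfun_dim\<close>)
  ultimately show ?thesis using Z V Vc by (simp add: mat_dim_simps matfun_dim Y_def)
qed

text \<open>A contraction is dilated to an isometry. The extra diagonal block carries \<delta> > 0
  instead of 0, so that the dilated matrix is positive definite; the resulting term with factor
  \<open>h \<delta>\<close> is nonnegative and is dropped from the left-hand side.\<close>

lemma contraction_monotone_approx:
  assumes h: "matrix_monotone_on {0..} h" and hpos: "\<forall>x>0. h x > 0" and X: "pd n X"
    and K: "dim_row K = n" "dim_col K = m" and E: "dim_row E = q" "dim_col E = m"
    and KE: "cadj K * K + cadj E * E = 1\<^sub>m m" and e: "e > 0" and \<delta>: "\<delta> > 0"
  shows "loewner_le (cadj K * matfun h X * K)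
    (matfun h (complex_of_real (1 + e) \<cdot>\<^sub>m (cadj K * X * K + complex_of_real \<delta> \<cdot>\<^sub>m (cadj E * E))))"
proof -
  note X' = pdD[OF X]
  let ?J = "inj_left n q" and ?L = "inj_right n q"
  define W where "W = ?J * X * cadj ?J + complex_of_real \<delta> \<cdot>\<^sub>m (?L * cadj ?L)"
  \<comment> \<open>\<open>V\<close> is the isometry with blocks \<open>K\<close>, \<open>E\<close>; compressing \<open>W = diag(X, \<delta>)\<close> by it gives the claim.\<close>
  define V where "V = ?J * K + ?L * E"
  have V: "dim_row V = n + q" "dim_col V = m" unfolding V_def using K E by auto
  have cV: "cadj V = cadj K * cadj ?J + cadj E * cadj ?L"
    unfolding V_def using K E by (simp add: cadj_add cadj_mult)
  have VV: "cadj V * V = 1\<^sub>m m"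
    unfolding cV unfolding V_def using K E by (simp add: mat_dim_simps inj_cancel KE)
  have Wd: "dim_row W = n + q" by (simp add: W_def)
  have JXJ: "hermitian (?J * X * cadj ?J)" using hermitian_congruence[OF X'(3), of "cadj ?J"] X' by simp
  have LL: "hermitian (?L * cadj ?L)" by (simp add: hermitian_iff cadj_mult)
  have Wh: "hermitian W" unfolding W_def by (intro hermitian_add hermitian_smult JXJ LL) simp
  obtain c where c: "c > 0" "loewner_le (complex_of_real c \<cdot>\<^sub>m 1\<^sub>m n) X" using pd_lower_bound[OF X] by blast
  have "0 < qform W v" if v: "dim_vec v = n + q" "v \<noteq> 0\<^sub>v (n + q)" for v
  proof -
    let ?u = "cadj ?J *\<^sub>v v" and ?w = "cadj ?L *\<^sub>v v"
    have qJ: "qform (?J * cadj ?J) v = qform (1\<^sub>m n) ?u"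
      using qform_congruence[of "cadj ?J" "1\<^sub>m n" v] v by (simp add: mat_dim_simps)
    have qL: "qform (?L * cadj ?L) v = qform (1\<^sub>m q) ?w"
      using qform_congruence[of "cadj ?L" "1\<^sub>m q" v] v by (simp add: mat_dim_simps)
    have qX: "qform (?J * X * cadj ?J) v = qform X ?u"
      using qform_congruence[of "cadj ?J" X v] v X' by simp
    have "qform (1\<^sub>m (n + q)) v = qform (1\<^sub>m n) ?u + qform (1\<^sub>m q) ?w"
      unfolding inj_complete[symmetric] using v
      by (subst qform_add[of _ "n + q"]) (auto simp: qJ qL)
    then have "0 < qform (1\<^sub>m n) ?u + qform (1\<^sub>m q) ?w" using qform_one_pos[OF v] by simp
    \<comment> \<open>\<open>min c \<delta>\<close> bounds both diagonal blocks of \<open>W\<close>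
      from below.\<close>
    then have "0 < min c \<delta> * (qform (1\<^sub>m n) ?u + qform (1\<^sub>m q) ?w)" using c \<delta> by simp
    also have "\<dots> = min c \<delta> * qform (1\<^sub>m n) ?u + min c \<delta> * qform (1\<^sub>m q) ?w" by (simp add: algebra_simps)
    also have "\<dots> \<le> c * qform (1\<^sub>m n) ?u + \<delta> * qform (1\<^sub>m q) ?w"
      by (intro add_mono mult_right_mono qform_one_nonneg) auto
    also have "c * qform (1\<^sub>m n) ?u \<le> qform X ?u"
      using c(2) X'(1) by (simp add: loewner_le_iff qform_smult[of _ n])
    also have "qform X ?u + \<delta> * qform (1\<^sub>m q) ?w = qform W v"
      unfolding W_def using v qX qL by (simp add: qform_add[of _ "n + q"] qform_smult[of _ "n + q"])
    finally show ?thesis by simp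
  qed
  then have W: "pd (n + q) W" using Wd Wh by (simp add: pd_iff)
  \<comment> \<open>The embeddings intertwine \<open>W\<close> with its diagonal blocks, so
    \<open>matfun h W\<close> acts block by block.\<close>
  have "W * ?J = ?J * X" unfolding W_def using X' by (simp add: mat_dim_simps inj_cancel)
  then have WJ: "matfun h W * ?J = ?J * matfun h X"
    using Wh X' Wd by (intro matfun_intertwine) auto
  have "W * ?L = ?L * (complex_of_real \<delta> \<cdot>\<^sub>m 1\<^sub>m q)" unfolding W_def using X' by (simp add: mat_dim_simps inj_cancel)
  then have "matfun h W * ?L = ?L * matfun h (complex_of_real \<delta> \<cdot>\<^sub>m 1\<^sub>m q)"
    using Wh Wd by (intro matfun_intertwine) (auto intro: hermitian_smult hermitian_one)
  then have WL: "matfun h W * ?L = complex_of_real (h \<delta>) \<cdot>\<^sub>m ?L"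
    by (simp add: matfun_scalar mat_dim_simps)
  have hd: "dim_row (matfun h W) = n + q" "dim_col (matfun h W) = n + q"
    "dim_row (matfun h X) = n" "dim_col (matfun h X) = n"
    using Wh X' Wd by (auto simp: matfun_dim)
  have WJ': "matfun h W * (?J * M) = ?J * (matfun h X * M)" if "dim_row M = n" for M
    using that hd by (simp flip: mat_mult_assoc_dim add: WJ)
  have WL': "matfun h W * (?L * M) = complex_of_real (h \<delta>) \<cdot>\<^sub>m (?L * M)" if "dim_row M = q" for M
    using that hd by (simp flip: mat_mult_assoc_dim add: WL mat_smult_mult_dim)
  have VhV: "cadj V * matfun h W * V = cadj K * matfun h X * K + complex_of_real (h \<delta>) \<cdot>\<^sub>m (cadj E * E)"
    unfolding cV unfolding V_def using K E hd by (simp add: mat_dim_simps inj_cancel WJ' WL')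
  have VWV: "cadj V * W * V = cadj K * X * K + complex_of_real \<delta> \<cdot>\<^sub>m (cadj E * E)"
    unfolding cV unfolding V_def W_def using K E X' by (simp add: mat_dim_simps inj_cancel)
  have KhK: "hermitian (cadj K * matfun h X * K)"
    by (intro hermitian_congruence hermitian_matfun X') (use K hd in simp)
  have "qform (cadj K * matfun h X * K) v \<le> qform (cadj V * matfun h W * V) v" if v: "dim_vec v = m" for v
  proof -
    have "qform (cadj E * E) v = qform (1\<^sub>m q) (E *\<^sub>v v)"
      using qform_congruence[of E "1\<^sub>m q" v] E v by (simp add: mat_dim_simps)
    also have "\<dots> \<ge> 0" using E by (intro qform_one_nonneg) simp
    finally have "0 \<le> h \<delta> * qform (cadj E * E) v" using hpos \<delta> by (simp add: less_imp_le)
    then show ?thesis unfolding VhV using K E v by (simp add: qform_add[of _ m] qform_smult[of _ m])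
  qed
  then have "loewner_le (cadj K * matfun h X * K) (cadj V * matfun h W * V)"
    unfolding loewner_le_iff using KhK K V hd hermitian_congruence[OF hermitian_matfun[OF Wh], of V h] by auto
  also note compression_monotone[OF h W V(1) VV e, unfolded VWV]
  finally (loewner_le_trans) show ?thesis .
qed

lemma matrix_monotone_scalar_mono:
  assumes h: "matrix_monotone_on {0..} h" and "0 < x" "x \<le> y"
  shows "h x \<le> h y"
proof -
  have "loewner_le (complex_of_real x \<cdot>\<^sub>m 1\<^sub>m 1) (complex_of_real y \<cdot>\<^sub>m 1\<^sub>m 1)"
    using assms by (simp only: loewner_le_scalar)
  from matrix_monotone_on_pd[OF h pd_smult[OF pd_one] this] assms
  show ?thesis by (simp only: matfun_scalar loewner_le_scalar)
qed

text \<open>If the claim failed, some \<open>s\<close> would lie strictly between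
  \<open>h x / h (t * x)\<close> and \<open>1 / t\<close>. The scalar contraction
  \<open>sqrt s\<close> bounds \<open>s * h (t * x)\<close> by \<open>h\<close> at a point near
  \<open>s * t * x\<close>. As \<open>s * t < 1\<close>, there is room to keep that point at most
  \<open>x\<close>, which contradicts the choice of \<open>s\<close> without any limit.\<close>

lemma matrix_monotone_sublinear:
  assumes h: "matrix_monotone_on {0..} h" and hpos: "\<forall>x>0. h x > 0" and t: "t > 1" and x: "x > 0"
  shows "h (t * x) \<le> t * h x"
proof (rule ccontr)
  assume "\<not> ?thesis"
  then have gt: "t * h x < h (t * x)" by simp
  have hx: "0 < h x" "0 < h (t * x)" using hpos x t by auto
  have "h x / h (t * x) < 1 / t" using gt hx t by (simp add: field_simps)
  then obtain s where s: "h x / h (t * x) < s" "s < 1 / t" using dense by blast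
  have s0: "0 < s" using s(1) hx by (meson divide_pos_pos less_trans)
  have st: "s * t < 1" using s(2) t by (simp add: field_simps)
  have "1 / t < 1" using t by simp
  then have s1: "s < 1" using s(2) by linarith
  define r where "r = s * t"
  \<comment> \<open>Chosen so that \<open>r * x + d = (1 + r) / 2 * x\<close> and
    \<open>(1 + e) * ((1 + r) / 2) = 1\<close>: the perturbed argument stays at most
    \<open>x\<close>.\<close>
  define e where "e = (1 - r) / (1 + r)"
  define d where "d = (1 - r) * x / 2"
  have r: "0 < r" "r < 1" using st s0 t by (auto simp: r_def)
  have e: "e > 0" using r by (simp add: e_def)
  have d: "d > 0" using r x by (simp add: d_def)
  let ?I = "1\<^sub>m 1 :: complex mat"
  have cs: "complex_of_real (sqrt s) * complex_of_real (sqrt s) = complex_of_real s"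
    "complex_of_real (sqrt (1 - s)) * complex_of_real (sqrt (1 - s)) = complex_of_real (1 - s)"
    using s0 s1 by (simp_all flip: of_real_mult)
  let ?K = "complex_of_real (sqrt s) \<cdot>\<^sub>m ?I" and ?E = "complex_of_real (sqrt (1 - s)) \<cdot>\<^sub>m ?I"
  have KE: "cadj ?K * ?K + cadj ?E * ?E = ?I"
  proof -
    have "cadj ?K * ?K = complex_of_real s \<cdot>\<^sub>m ?I" by (simp add: cadj_smult mat_dim_simps cs)
    moreover have "cadj ?E * ?E = complex_of_real (1 - s) \<cdot>\<^sub>m ?I"
      by (simp add: cadj_smult mat_dim_simps cs del: of_real_diff)
    ultimately show ?thesis by (intro eq_matI) auto
  qed
  have "loewner_le (cadj ?K * matfun h (complex_of_real (t * x) \<cdot>\<^sub>m ?I) * ?K)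
    (matfun h (complex_of_real (1 + e) \<cdot>\<^sub>m (cadj ?K * (complex_of_real (t * x) \<cdot>\<^sub>m ?I) * ?K
      + complex_of_real d \<cdot>\<^sub>m (cadj ?E * ?E))))"
    by (rule contraction_monotone_approx[OF h hpos pd_smult[OF pd_one] _ _ _ _ KE e d]) (use t x in auto)
  also have "cadj ?K * matfun h (complex_of_real (t * x) \<cdot>\<^sub>m ?I) * ?K = complex_of_real (s * h (t * x)) \<cdot>\<^sub>m ?I"
    unfolding matfun_scalar
    by (rule eq_matI) (auto simp: cadj_smult mat_dim_simps mult.left_commute cs mult.commute)
  also have "complex_of_real (1 + e) \<cdot>\<^sub>m (cadj ?K * (complex_of_real (t * x) \<cdot>\<^sub>m ?I) * ?K
      + complex_of_real d \<cdot>\<^sub>m (cadj ?E * ?E)) = complex_of_real ((1 + e) * (s * (t * x) + d * (1 - s))) \<cdot>\<^sub>m ?I"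
    by (rule eq_matI) (auto simp: cadj_smult mat_dim_simps mult.left_commute cs mult.commute)
  finally have "s * h (t * x) \<le> h ((1 + e) * (s * (t * x) + d * (1 - s)))"
    by (simp only: matfun_scalar loewner_le_scalar)
  also have "\<dots> \<le> h x"
  proof (rule matrix_monotone_scalar_mono[OF h])
    show "0 < (1 + e) * (s * (t * x) + d * (1 - s))"
      using e s0 s1 t x d by (intro mult_pos_pos add_pos_pos) auto
    have "s * (t * x) + d * (1 - s) \<le> r * x + d"
      using d s0 by (simp add: r_def algebra_simps)
    also have "\<dots> = (1 + r) / 2 * x" by (simp add: d_def field_simps)
    finally have "(1 + e) * (s * (t * x) + d * (1 - s)) \<le> (1 + e) * ((1 + r) / 2 * x)"
      using e by (intro mult_left_mono) auto
    also have "\<dots> = x" using r by (simp add: e_def field_simps)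
    finally show "(1 + e) * (s * (t * x) + d * (1 - s)) \<le> x" .
  qed
  finally have "s * h (t * x) \<le> h x" .
  then show False using s(1) hx by (simp add: field_simps)
qed

text \<open>The approximate inequality is applied with \<open>E\<close> completing \<open>K\<close>
  to an isometry. Its perturbation is absorbed into a multiple of \<open>Y\<close>, the factor
  \<open>(1 + e)\<^sup>2\<close> is moved out of \<open>h\<close> by sublinearity, and
  \<open>e\<close> tends to 0. The left inverse \<open>L\<close> keeps \<open>Y\<close> positive
  definite.\<close>

theorem hansen_inequality:
  assumes h: "matrix_monotone_on {0..} h" and hpos: "\<forall>x>0. h x > 0" and X: "pd n X"
    and K: "dim_row K = n" "L * K = 1\<^sub>m m" "dim_col L = n" and KK: "loewner_le (cadj K * K) (1\<^sub>m m)"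
  shows "loewner_le (cadj K * matfun h X * K) (matfun h (cadj K * X * K))"
proof -
  note X' = pdD[OF X]
  have Kc: "dim_col K = m" using K(2) by (metis index_mult_mat(3) index_one_mat(3))
  define Y where "Y = cadj K * X * K"
  have Y: "pd m Y" unfolding Y_def by (rule pd_congruence[OF X K])
  note Y' = pdD[OF Y]
  have "psd (1\<^sub>m m - cadj K * K)" using KK by (simp add: loewner_le_def)
  then obtain E where E: "dim_row E = m" "dim_col E = m" "cadj E * E = 1\<^sub>m m - cadj K * K"
    using psd_sqrt[of "1\<^sub>m m - cadj K * K" m] Kc by auto
  have KE: "cadj K * K + cadj E * E = 1\<^sub>m m"
    unfolding E(3) using Kc by (intro eq_matI) (simp_all del: index_mult_mat(1))
  obtain c where c: "c > 0" "loewner_le (complex_of_real c \<cdot>\<^sub>m 1\<^sub>m m) Y" using pd_lower_bound[OF Y] by blast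
  have EE: "hermitian (cadj E * E)" by (simp add: hermitian_iff cadj_mult)
  have hY: "hermitian (matfun h Y)" "dim_row (matfun h Y) = m" using Y' by (auto simp: hermitian_matfun matfun_dim)
  have hX: "hermitian (matfun h X)" "dim_row (matfun h X) = n" using X' by (auto simp: hermitian_matfun matfun_dim)
  have approx: "qform (cadj K * matfun h X * K) v \<le> (1 + e)\<^sup>2 * qform (matfun h Y) v"
    if e: "e > 0" and v: "dim_vec v = m" for e v
  proof -
    \<comment> \<open>\<open>Y\<close> is at least \<open>c\<close> times the identity and
      \<open>cadj E * E\<close> is at most the identity, so the perturbation is at most
      \<open>e\<close> times \<open>Y\<close>.\<close>
    define \<delta> where "\<delta> = e * c"
    have \<delta>: "\<delta> > 0" using e c by (simp add: \<delta>_def)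
    define Z where "Z = complex_of_real (1 + e) \<cdot>\<^sub>m (Y + complex_of_real \<delta> \<cdot>\<^sub>m (cadj E * E))"
    have 1: "loewner_le (cadj K * matfun h X * K) (matfun h Z)"
      unfolding Z_def Y_def by (rule contraction_monotone_approx[OF h hpos X K(1) Kc E(1,2) KE e \<delta>])
    have qZ: "qform Z w = (1 + e) * (qform Y w + \<delta> * qform (cadj E * E) w)" if "dim_vec w = m" for w
      unfolding Z_def using that Y' E(1,2)
      by (simp add: qform_smult[of _ m] qform_add[of _ m] del: of_real_add)
    have Zh: "hermitian Z" "dim_row Z = m"
      unfolding Z_def by (intro hermitian_smult hermitian_add Y' EE) (use Y' E(1,2) in auto)
    have qE: "qform (cadj E * E) w = qform (1\<^sub>m m) (E *\<^sub>v w)" if "dim_vec w = m" for w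
      using qform_congruence[of E "1\<^sub>m m" w] E(1,2) that by (simp add: mat_dim_simps)
    have qE0: "qform (cadj E * E) w \<ge> 0" if "dim_vec w = m" for w
      unfolding qE[OF that] using E by (intro qform_one_nonneg) simp
    have qK0: "qform (cadj K * K) w \<ge> 0" if "dim_vec w = m" for w
      using qform_congruence[of K "1\<^sub>m n" w] K(1) Kc that qform_one_nonneg[of "K *\<^sub>v w" n]
      by (simp add: mat_dim_simps)
    have qE1: "qform (cadj E * E) w \<le> qform (1\<^sub>m m) w" if "dim_vec w = m" for w
      unfolding E(3) using qK0[OF that] that Kc by (simp add: qform_minus[of _ m])
    have cY: "c * qform (1\<^sub>m m) w \<le> qform Y w" if "dim_vec w = m" for w
      using c(2) Y'(1) that by (simp add: loewner_le_iff qform_smult[of _ m])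
    have "qform Y w \<le> qform Z w" if w: "dim_vec w = m" for w
    proof -
      have "qform Y w \<le> qform Y w + \<delta> * qform (cadj E * E) w" using qE0[OF w] \<delta> by simp
      also have "\<dots> \<le> (1 + e) * \<dots>"
        using e pd_nonneg[OF Y w] qE0[OF w] \<delta> by (simp add: algebra_simps)
      finally show ?thesis using qZ[OF w] by simp
    qed
    then have "pd m Z" using Y Zh Y' pd_loewner_le[of m Y Z] by (simp add: loewner_le_iff)
    have "qform Z w \<le> qform (complex_of_real ((1 + e)\<^sup>2) \<cdot>\<^sub>m Y) w" if w: "dim_vec w = m" for w
    proof -
      have "\<delta> * qform (cadj E * E) w \<le> e * (c * qform (1\<^sub>m m) w)"
        using qE1[OF w] \<delta> e c by (simp add: \<delta>_def)
      also have "\<dots> \<le> e * qform Y w" using cY[OF w] e by simp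
      finally have "(1 + e) * (qform Y w + \<delta> * qform (cadj E * E) w) \<le> (1 + e) * (qform Y w + e * qform Y w)"
        using e by (intro mult_left_mono) auto
      also have "\<dots> = (1 + e)\<^sup>2 * qform Y w" by (simp add: algebra_simps power2_eq_square)
      finally show ?thesis using qZ[OF w] w Y' by (simp add: qform_smult[of _ m] del: of_real_power of_real_add)
    qed
    then have "loewner_le Z (complex_of_real ((1 + e)\<^sup>2) \<cdot>\<^sub>m Y)"
      using Zh Y' by (simp add: loewner_le_iff hermitian_smult del: of_real_power of_real_add)
    from matrix_monotone_on_pd[OF h \<open>pd m Z\<close> this]
    have "loewner_le (matfun h Z) (matfun (\<lambda>x. h ((1 + e)\<^sup>2 * x)) Y)"
      using Y' by (simp only: matfun_smult)
    moreover have "loewner_le (matfun (\<lambda>x. h ((1 + e)\<^sup>2 * x)) Y) (matfun (\<lambda>x. (1 + e)\<^sup>2 * h x) Y)"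
    proof (rule loewner_le_matfun[OF Y])
      fix x :: real assume "x > 0"
      moreover have "(1 + e)\<^sup>2 > 1" using e by (simp add: power2_eq_square algebra_simps add_pos_pos)
      ultimately show "h ((1 + e)\<^sup>2 * x) \<le> (1 + e)\<^sup>2 * h x"
        using matrix_monotone_sublinear[OF h hpos] by blast
    qed
    ultimately have "loewner_le (cadj K * matfun h X * K) (complex_of_real ((1 + e)\<^sup>2) \<cdot>\<^sub>m matfun h Y)"
      using 1 loewner_le_trans matfun_cmult[OF Y'(3)] by metis
    then have "qform (cadj K * matfun h X * K) v \<le> qform (complex_of_real ((1 + e)\<^sup>2) \<cdot>\<^sub>m matfun h Y) v"
      using v Kc by (simp add: loewner_le_iff)
    also have "\<dots> = (1 + e)\<^sup>2 * qform (matfun h Y) v"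
      by (rule qform_smult[of _ m]) (use hY hermitianD[OF hY(1)] v in auto)
    finally show ?thesis .
  qed
  have "qform (cadj K * matfun h X * K) v \<le> qform (matfun h Y) v" if v: "dim_vec v = m" for v
  proof -
    \<comment> \<open>\<open>e\<close> now occurs only in a scalar factor; the matrices and
      \<open>v\<close> are fixed.\<close>
    have "((\<lambda>e. (1 + e)\<^sup>2 * qform (matfun h Y) v) \<longlongrightarrow> (1 + 0)\<^sup>2 * qform (matfun h Y) v) (at_right (0::real))"
      by (intro tendsto_intros)
    moreover have "\<forall>\<^sub>F e in at_right (0::real). qform (cadj K * matfun h X * K) v \<le> (1 + e)\<^sup>2 * qform (matfun h Y) v"
      using approx v by (auto simp: eventually_at_right_less intro: eventually_mono[OF eventually_at_right_less])
    ultimately have "qform (cadj K * matfun h X * K) v \<le> (1 + 0)\<^sup>2 * qform (matfun h Y) v"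
      by (rule tendsto_lowerbound) simp
    then show ?thesis by simp
  qed
  then show ?thesis
    using hY hX K Kc hermitian_congruence[OF hX(1), of K] by (simp add: loewner_le_iff flip: Y_def)
qed

section \<open>Operator means\<close>

lemma sqrt_mult_mult_sqrt: "x \<ge> 0 \<Longrightarrow> sqrt x * y * sqrt x = x * y"
  by (metis mult.assoc mult.commute real_sqrt_mult_self abs_of_nonneg)

lemma pd_sqrt_facts:
  assumes "pd n A"
  defines "S \<equiv> matfun sqrt A" and "T \<equiv> matfun (\<lambda>x. 1 / sqrt x) A"
  shows "pd n S" "pd n T" "S * S = A" "S * T = 1\<^sub>m n" "T * S = 1\<^sub>m n"
proof -
  note A = pdD[OF assms(1)]
  show "pd n S" "pd n T" unfolding S_def T_def by (intro pd_matfun[OF assms(1)]; simp)+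
  have "S * S = matfun (\<lambda>x. x) A"
    unfolding S_def matfun_mult[OF A(3)] by (rule matfun_cong[OF assms(1)]) simp
  then show "S * S = A" using A by (simp add: matfun_ident)
  have 1: "matfun (\<lambda>x. 1) A = 1\<^sub>m n"
    unfolding matfun_const[OF A(3)] A(1) by (rule eq_matI) auto
  show "S * T = 1\<^sub>m n" "T * S = 1\<^sub>m n"
    unfolding S_def T_def matfun_mult[OF A(3)] 1[symmetric] by (rule matfun_cong[OF assms(1)]; simp)+
qed

lemma mean_sigma_mono_right:
  assumes h: "matrix_monotone_on {0..} h" and A: "pd n A" and B: "pd n B" and le: "loewner_le B B'"
  shows "loewner_le (mean_sigma h A B) (mean_sigma h A B')"
proof -
  define S where "S = matfun sqrt A"
  define T where "T = matfun (\<lambda>x. 1 / sqrt x) A"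
  note ST = pd_sqrt_facts[OF A, folded S_def T_def]
  note S = pdD[OF ST(1)] and T = pdD[OF ST(2)] and B' = pdD[OF B]
  have TBT: "pd n (T * B * T)" using pd_congruence[OF B _ ST(4)] S T by simp
  have le': "loewner_le (T * B * T) (T * B' * T)"
    using loewner_le_congruence[OF le, of T] T B' by simp
  have "loewner_le (S * matfun h (T * B * T) * S) (S * matfun h (T * B' * T) * S)"
    using loewner_le_congruence[OF matrix_monotone_on_pd[OF h TBT le'], of S] S pdD[OF TBT]
    by (simp add: matfun_dim)
  then show ?thesis unfolding mean_sigma_def Let_def S_def T_def .
qed

text \<open>\<open>K = S * T'\<close> is a contraction because \<open>A\<close> is below
  \<open>A'\<close>, and it carries \<open>T * B * T\<close> to \<open>T' * B * T'\<close>. Hansen's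
  inequality followed by congruence with \<open>S'\<close> gives the claim, since
  \<open>K * S' = S\<close>.\<close>

lemma mean_sigma_mono_left:
  assumes h: "matrix_monotone_on {0..} h" and hpos: "\<forall>x>0. h x > 0"
    and A: "pd n A" and B: "pd n B" and le: "loewner_le A A'"
  shows "loewner_le (mean_sigma h A B) (mean_sigma h A' B)"
proof -
  have A': "pd n A'" by (rule pd_loewner_le[OF A le])
  define S where "S = matfun sqrt A"
  define T where "T = matfun (\<lambda>x. 1 / sqrt x) A"
  define S' where "S' = matfun sqrt A'"
  define T' where "T' = matfun (\<lambda>x. 1 / sqrt x) A'"
  note ST = pd_sqrt_facts[OF A, folded S_def T_def]
  note ST' = pd_sqrt_facts[OF A', folded S'_def T'_def]
  note d = pdD[OF ST(1)] pdD[OF ST(2)] pdD[OF ST'(1)] pdD[OF ST'(2)] pdD[OF A] pdD[OF B] pdD[OF A']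
  note cancel = mat_cancel_left[OF ST(4)] mat_cancel_left[OF ST(5)]
    mat_cancel_left[OF ST'(4)] mat_cancel_left[OF ST'(5)]
  define K where "K = S * T'"
  have K: "dim_row K = n" "dim_col K = n" "cadj K = T' * S" unfolding K_def using d by (auto simp: cadj_mult)
  have inv: "(S' * T) * K = 1\<^sub>m n" unfolding K_def using d cancel ST' by (simp add: mat_dim_simps)
  have TBT: "pd n (T * B * T)" using pd_congruence[OF B _ ST(4)] d by simp
  have "loewner_le (T' * A * T') (T' * A' * T')"
    using loewner_le_congruence[OF le, of T'] d by simp
  moreover have "T' * A * T' = cadj K * K"
    unfolding K(3) unfolding K_def ST(3)[symmetric] using d by (simp add: mat_dim_simps)
  moreover have "T' * A' * T' = 1\<^sub>m n"
    unfolding ST'(3)[symmetric] using d cancel ST'(4,5) by (simp add: mat_dim_simps)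
  ultimately have KK: "loewner_le (cadj K * K) (1\<^sub>m n)" by simp
  have KXK: "cadj K * (T * B * T) * K = T' * B * T'"
    unfolding K(3) unfolding K_def using d cancel by (simp add: mat_dim_simps)
  have hd: "dim_row (matfun h (T * B * T)) = n" "dim_col (matfun h (T * B * T)) = n"
    using pdD[OF TBT] by (simp_all add: matfun_dim)
  have "loewner_le (cadj K * matfun h (T * B * T) * K) (matfun h (T' * B * T'))"
    using hansen_inequality[OF h hpos TBT K(1) inv _ KK] d unfolding KXK by simp
  from loewner_le_congruence[OF this, of S']
  have "loewner_le (S' * (cadj K * matfun h (T * B * T) * K) * S') (S' * matfun h (T' * B * T') * S')"
    using d K by simp
  also have "S' * (cadj K * matfun h (T * B * T) * K) * S' = S * matfun h (T * B * T) * S"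
    unfolding K(3) unfolding K_def using d cancel hd ST' by (simp add: mat_dim_simps)
  finally show ?thesis unfolding mean_sigma_def Let_def S_def T_def S'_def T'_def .
qed

lemma mean_sigma_mono:
  assumes h: "matrix_monotone_on {0..} h" and hpos: "\<forall>x>0. h x > 0"
    and A: "pd n A" and B: "pd n B" and le: "loewner_le A A'" "loewner_le B B'"
  shows "loewner_le (mean_sigma h A B) (mean_sigma h A' B')"
  using mean_sigma_mono_right[OF h A B le(2)]
    mean_sigma_mono_left[OF h hpos A pd_loewner_le[OF B le(2)] le(1)] by (rule loewner_le_trans)

text \<open>Any invertible factor \<open>R\<close> of \<open>P\<close> may replace its positive
  square root: by polar decomposition the two differ by a unitary matrix, and the functional
  calculus commutes with unitary conjugation.\<close>

lemma mean_sigma_factor: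
  assumes P: "pd n P" and Q: "pd n Q" and R: "P = cadj R * R"
    and inv: "R * R' = 1\<^sub>m n" "R' * R = 1\<^sub>m n" and dims: "dim_row R = n" "dim_col R = n" "dim_row R' = n" "dim_col R' = n"
  shows "mean_sigma h P Q = cadj R * matfun h (cadj R' * Q * R') * R"
proof -
  define S where "S = matfun sqrt P"
  define T where "T = matfun (\<lambda>x. 1 / sqrt x) P"
  note ST = pd_sqrt_facts[OF P, folded S_def T_def]
  note d = pdD[OF ST(1)] pdD[OF ST(2)] pdD[OF P] pdD[OF Q] dims
  note cancel = mat_cancel_left[OF ST(4)] mat_cancel_left[OF ST(5)]
    mat_cancel_left[OF inv(1)] mat_cancel_left[OF inv(2)]
  \<comment> \<open>The unitary polar factor of \<open>R\<close>.\<close>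
  define W where "W = R * T"
  have W: "dim_row W = n" "dim_col W = n" "cadj W = T * cadj R"
    unfolding W_def using d by (auto simp: cadj_mult)
  have "cadj W * W = T * P * T" unfolding W(3) unfolding W_def R using d by (simp add: mat_dim_simps)
  also have "\<dots> = 1\<^sub>m n" unfolding ST(3)[symmetric] using d cancel ST(4,5) by (simp add: mat_dim_simps)
  finally have U: "unitary n W" using W by (intro unitaryI)
  note U' = unitaryD[OF U]
  have RWS: "R = W * S" unfolding W_def using d ST by (simp add: mat_dim_simps)
  have "R' = T * cadj W"
  proof -
    have "R' = R' * (W * cadj W)" using d U' by (simp add: mat_dim_simps)
    also have "\<dots> = T * cadj W" unfolding W_def using d cancel by (simp add: mat_dim_simps cadj_mult)
    finally show ?thesis .
  qed
  then have R'W: "R' * W = T" using d W U' by (simp add: mat_dim_simps)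
  have cR'W: "cadj W * cadj R' = T" using arg_cong[OF R'W, of cadj] d W by (simp add: cadj_mult)
  define Y where "Y = T * Q * T"
  have Y: "hermitian Y" unfolding Y_def using hermitian_congruence[of Q T] d by simp
  have Yd: "dim_row Y = n" "dim_col Y = n" unfolding Y_def using d by auto
  define Z where "Z = cadj R' * Q * R'"
  have Z: "hermitian Z" unfolding Z_def by (rule hermitian_congruence) (use d in auto)
  have Zd: "dim_row Z = n" "dim_col Z = n" unfolding Z_def using d by auto
  have "Z * W = W * Y"
  proof -
    have "Z * W = W * (cadj W * Z * W)" using W(1,2) Zd mat_cancel_left[OF U'(3)] by (simp add: mat_dim_simps)
    also have "cadj W * Z * W = (cadj W * cadj R') * Q * (R' * W)"
      unfolding Z_def using d W by (simp add: mat_dim_simps)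
    also have "\<dots> = Y" unfolding R'W cR'W Y_def ..
    finally show ?thesis .
  qed
  then have hZ: "matfun h Z * W = W * matfun h Y" by (intro matfun_intertwine Z Y) (use W Zd Yd in auto)
  have hd: "dim_row (matfun h Z) = n" "dim_col (matfun h Z) = n" "dim_row (matfun h Y) = n" "dim_col (matfun h Y) = n"
    using Z Y Zd Yd by (auto simp: matfun_dim)
  have "cadj R * matfun h Z * R = S * cadj W * ((matfun h Z * W) * S)"
    unfolding RWS using d W hd by (simp add: cadj_mult mat_dim_simps)
  also have "\<dots> = S * matfun h Y * S"
    unfolding hZ using d W hd mat_cancel_left[OF U'(4)] by (simp add: mat_dim_simps)
  finally show ?thesis unfolding mean_sigma_def Let_def S_def T_def Z_def Y_def by simp
qed

text \<open>\<open>S * R\<close> is a factor of \<open>R * P * R\<close> with inverse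
  \<open>R' * T\<close>. It need not be Hermitian, hence the detour through
  \<open>mean_sigma_factor\<close>.\<close>

lemma mean_sigma_congruence:
  assumes P: "pd n P" and Q: "pd n Q" and R: "pd n R" and inv: "R * R' = 1\<^sub>m n" "R' * R = 1\<^sub>m n"
    and dims: "dim_row R' = n" "dim_col R' = n"
  shows "mean_sigma h (R * P * R) (R * Q * R) = R * mean_sigma h P Q * R"
proof -
  define S where "S = matfun sqrt P"
  define T where "T = matfun (\<lambda>x. 1 / sqrt x) P"
  note ST = pd_sqrt_facts[OF P, folded S_def T_def]
  note d = pdD[OF ST(1)] pdD[OF ST(2)] pdD[OF P] pdD[OF Q] pdD[OF R] dims
  have "cadj (R * R') = 1\<^sub>m n" unfolding inv by simp
  then have inv': "cadj R' * R = 1\<^sub>m n" using d by (simp add: cadj_mult)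
  note cancel = mat_cancel_left[OF ST(4)] mat_cancel_left[OF ST(5)]
    mat_cancel_left[OF inv(1)] mat_cancel_left[OF inv(2)] mat_cancel_left[OF inv']
  have P': "pd n (R * P * R)" using pd_congruence[OF P _ inv(2)] d by simp
  have Q': "pd n (R * Q * R)" using pd_congruence[OF Q _ inv(2)] d by simp
  have 1: "R * P * R = cadj (S * R) * (S * R)"
    unfolding ST(3)[symmetric] using d by (simp add: cadj_mult mat_dim_simps)
  have "mean_sigma h (R * P * R) (R * Q * R)
      = cadj (S * R) * matfun h (cadj (R' * T) * (R * Q * R) * (R' * T)) * (S * R)"
    by (rule mean_sigma_factor[OF P' Q' 1]) (use d cancel ST inv in \<open>auto simp: mat_dim_simps\<close>)
  also have "cadj (R' * T) * (R * Q * R) * (R' * T) = T * Q * T"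
    using d cancel by (simp add: cadj_mult mat_dim_simps)
  also have "cadj (S * R) * matfun h (T * Q * T) * (S * R) = R * (S * matfun h (T * Q * T) * S) * R"
    using d hermitian_congruence[of Q T] matfun_dim[of "T * Q * T" h] by (simp add: cadj_mult mat_dim_simps)
  finally show ?thesis unfolding mean_sigma_def Let_def S_def T_def .
qed

text \<open>Functions of one matrix commute, so their mean reduces to the scalar mean of the
  eigenvalues.\<close>

lemma mean_sigma_matfun:
  assumes C: "pd n C" and u: "\<And>x. x > 0 \<Longrightarrow> u x > 0" and w: "\<And>x. x > 0 \<Longrightarrow> w x > 0"
  shows "mean_sigma h (matfun u C) (matfun w C) = matfun (\<lambda>x. u x * h (w x / u x)) C"
proof -
  note C' = pdD[OF C]
  have "mean_sigma h (matfun u C) (matfun w C) =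
     matfun (\<lambda>x. sqrt (u x) * h (1 / sqrt (u x) * w x * (1 / sqrt (u x))) * sqrt (u x)) C"
    unfolding mean_sigma_def Let_def using C' by (simp add: matfun_compose matfun_mult)
  also have "\<dots> = matfun (\<lambda>x. u x * h (w x / u x)) C"
  proof (rule matfun_cong[OF C])
    fix x :: real assume "x > 0"
    then have "u x > 0" by (rule u)
    then have "1 / sqrt (u x) * w x * (1 / sqrt (u x)) = w x / u x" by (simp add: field_simps)
    moreover have "sqrt (u x) * y * sqrt (u x) = u x * y" for y
      using \<open>u x > 0\<close> by (intro sqrt_mult_mult_sqrt) simp
    ultimately show "sqrt (u x) * h (1 / sqrt (u x) * w x * (1 / sqrt (u x))) * sqrt (u x) = u x * h (w x / u x)"
      by (simp only:)
  qed
  finally show ?thesis .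
qed

text \<open>With \<open>F\<close> and \<open>G\<close> the inverses of \<open>A\<close> and
  \<open>B\<close>, the positive matrix \<open>(G - F) * A * (G - F)\<close> equals
  \<open>G * A * G - G - (G - F)\<close>, and \<open>G * A * G\<close> is at most
  \<open>G * B * G = G\<close>. Hence \<open>G - F\<close> has a nonpositive form.\<close>

lemma loewner_le_inverse:
  assumes A: "pd n A" and le: "loewner_le A B"
  shows "loewner_le (matfun (\<lambda>x. 1 / x) B) (matfun (\<lambda>x. 1 / x) A)"
proof -
  have B: "pd n B" by (rule pd_loewner_le[OF A le])
  note A' = pdD[OF A] and B' = pdD[OF B]
  define F where "F = matfun (\<lambda>x. 1 / x) A"
  define G where "G = matfun (\<lambda>x. 1 / x) B"
  have inv: "M * matfun (\<lambda>x. 1 / x) M = 1\<^sub>m n \<and> matfun (\<lambda>x. 1 / x) M * M = 1\<^sub>m n" if M: "pd n M" for M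
  proof -
    note M' = pdD[OF M]
    have 1: "matfun (\<lambda>x. 1) M = 1\<^sub>m n"
      unfolding matfun_const[OF M'(3)] M'(1) by (rule eq_matI) auto
    have "matfun (\<lambda>x. x) M * matfun (\<lambda>x. 1 / x) M = matfun (\<lambda>x. 1) M"
      "matfun (\<lambda>x. 1 / x) M * matfun (\<lambda>x. x) M = matfun (\<lambda>x. 1) M"
      unfolding matfun_mult[OF M'(3)] by (rule matfun_cong[OF M]; simp)+
    then show ?thesis unfolding 1 using M' by (simp add: matfun_ident)
  qed
  have F: "pd n F" unfolding F_def by (rule pd_matfun[OF A]) simp
  have G: "pd n G" unfolding G_def by (rule pd_matfun[OF B]) simp
  note d = A' B' pdD[OF F] pdD[OF G]
  have iF: "A * F = 1\<^sub>m n" "F * A = 1\<^sub>m n" using inv[OF A] by (auto simp: F_def)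
  have iG: "B * G = 1\<^sub>m n" "G * B = 1\<^sub>m n" using inv[OF B] by (auto simp: G_def)
  have "qform G v \<le> qform F v" if v: "dim_vec v = n" for v
  proof -
    have "(G - F) * A * (G - F) = G * A * G - G - (G - F)"
      using d iF mat_cancel_left[OF iF(2)] by (simp add: mat_dim_simps)
    then have "qform (G - F) v \<le> qform (G * A * G - G) v"
      using qform_congruence[of "G - F" A v] pd_nonneg[OF A, of "(G - F) *\<^sub>v v"] d v
      by (simp add: cadj_minus qform_minus[of _ n])
    moreover have "G * B * G = G" using d iG by (simp add: mat_dim_simps)
    moreover have "qform (G * A * G) v \<le> qform (G * B * G) v"
      using loewner_le_congruence[OF le, of G] d v by (simp add: loewner_le_iff)
    ultimately show ?thesis using d v by (simp add: qform_minus[of _ n])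
  qed
  then show ?thesis using d by (simp add: loewner_le_iff flip: F_def G_def)
qed

section \<open>One step, from a pair of matrices to its image under f\<close>

locale ando_hiai =
  fixes n :: nat and A B :: "complex mat" and g h :: "real \<Rightarrow> real"
  assumes A: "pd n A" and B: "pd n B"
    and g_mono: "matrix_monotone_on {0..} g" and h_mono: "matrix_monotone_on {0..} h"
    and g_pos: "x > 0 \<Longrightarrow> g x > 0" and h_pos: "x > 0 \<Longrightarrow> h x > 0"
begin

definition "S = matfun sqrt A"
definition "T = matfun (\<lambda>x. 1 / sqrt x) A"
definition "C = T * B * T"
definition "R = matfun sqrt C"
text \<open>\<open>G\<close> and \<open>H\<close> are what is left of f(A) and f(B) once the
  congruence by \<open>S\<close> is stripped off; see \<open>fA\<close> and
  \<open>fB\<close>.\<close>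

definition "G = matfun g A"
definition "H = R * matfun g (R * A * R) * R"

lemmas ST = pd_sqrt_facts[OF A, folded S_def T_def]

lemma C: "pd n C"
  unfolding C_def using pd_congruence[OF B _ ST(4)] pdD[OF ST(1)] pdD[OF ST(2)] by simp

lemmas RR = pd_sqrt_facts[OF C, folded R_def]
lemmas dims = pdD[OF A] pdD[OF B] pdD[OF ST(1)] pdD[OF ST(2)] pdD[OF C] pdD[OF RR(1)]

lemma RAR: "pd n (R * A * R)"
  using pd_congruence[OF A _ RR(5)] dims pdD[OF RR(2)] by simp

lemma G: "pd n G"
  unfolding G_def by (rule pd_matfun[OF A g_pos])

lemma H: "pd n H"
  unfolding H_def using pd_congruence[OF pd_matfun[OF RAR g_pos] _ RR(5)] dims pdD[OF RR(2)] by simp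

lemma sigma_eq: "mean_sigma h A B = S * matfun h C * S"
  by (simp add: mean_sigma_def Let_def S_def T_def C_def)

lemma fA: "matfun (\<lambda>x. x * g x) A = S * G * S"
proof -
  have "S * G * S = matfun (\<lambda>x. sqrt x * g x * sqrt x) A"
    unfolding S_def G_def using dims by (simp add: matfun_mult)
  also have "\<dots> = matfun (\<lambda>x. x * g x) A"
    by (rule matfun_cong[OF A]) (simp add: sqrt_mult_mult_sqrt)
  finally show ?thesis ..
qed

text \<open>With \<open>X = S * R\<close>, the matrix \<open>B\<close> is \<open>X * cadj X\<close>,
  while \<open>cadj X * X\<close> is \<open>R * A * R\<close>. So \<open>X\<close> intertwines
  \<open>B\<close> with \<open>R * A * R\<close>, and f(B), read as \<open>matfun g B * B\<close>,
  becomes \<open>X * matfun g (R * A * R) * cadj X\<close>.\<close>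

lemma fB: "matfun (\<lambda>x. x * g x) B = S * H * S"
proof -
  have B_eq: "B = S * R * (R * S)"
  proof -
    have "S * R * (R * S) = S * (R * R) * S" using dims by (simp add: mat_dim_simps)
    also have "\<dots> = B" unfolding RR(3) C_def
      using dims mat_cancel_left[OF ST(4)] ST by (simp add: mat_dim_simps)
    finally show ?thesis ..
  qed
  have "R * S * (S * R) = R * (S * S) * R" using dims by (simp add: mat_dim_simps)
  then have RSSR: "R * S * (S * R) = R * A * R" unfolding ST(3) .
  have "B * (S * R) = (S * R) * (R * A * R)"
    unfolding RSSR[symmetric] by (subst B_eq) (use dims in \<open>simp add: mat_dim_simps\<close>)
  then have gB: "matfun g B * (S * R) = (S * R) * matfun g (R * A * R)"
    by (intro matfun_intertwine) (use dims pdD[OF RAR] in auto)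
  have gd: "dim_row (matfun g B) = n" "dim_col (matfun g B) = n"
    "dim_row (matfun g (R * A * R)) = n" "dim_col (matfun g (R * A * R)) = n"
    using dims pdD[OF RAR] by (simp_all add: matfun_dim)
  have "matfun (\<lambda>x. x * g x) B = matfun (\<lambda>x. g x * x) B" by (simp add: mult.commute)
  also have "\<dots> = matfun g B * B" using matfun_mult[of B g "\<lambda>x. x"] dims by (simp add: matfun_ident)
  also have "\<dots> = matfun g B * (S * R) * (R * S)" by (subst (2) B_eq) (use dims gd in \<open>simp add: mat_dim_simps\<close>)
  also have "\<dots> = S * H * S" unfolding gB H_def using dims gd by (simp add: mat_dim_simps)
  finally show ?thesis .
qed

lemma f_sigma: "mean_sigma h (matfun (\<lambda>x. x * g x) A) (matfun (\<lambda>x. x * g x) B) = S * mean_sigma h G H * S"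
  unfolding fA fB by (rule mean_sigma_congruence[OF G H ST(1) ST(4,5)]) (use dims in auto)

lemma f_sigma_dim: "dim_row (mean_sigma h G H) = n"
  unfolding mean_sigma_def Let_def using pdD[OF G] by (simp add: matfun_dim)

lemma inverse_hC: "matfun (\<lambda>x. 1 / x) (matfun h C) = matfun (\<lambda>x. 1 / h x) C"
  using dims by (simp add: matfun_compose)

lemma inverse_inverse_A: "matfun (\<lambda>x. 1 / x) (matfun (\<lambda>x. 1 / x) A) = A"
  using dims by (simp add: matfun_compose matfun_ident)

lemma TT: "T * T = matfun (\<lambda>x. 1 / x) A"
  unfolding T_def using dims by (simp add: matfun_mult) (rule matfun_cong[OF A], simp)

lemma T_sigma_T: "T * mean_sigma h A B * T = matfun h C"
  unfolding sigma_eq using dims mat_cancel_left[OF ST(5)] ST matfun_dim[of C h] by (simp add: mat_dim_simps)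

lemma hC: "pd n (matfun h C)" by (rule pd_matfun[OF C h_pos])

text \<open>Congruence by \<open>T\<close> removes the outer \<open>S\<close> and leaves
  \<open>matfun h C\<close> below the inverse of \<open>A\<close>; inverting reverses the
  order.\<close>

lemma A_le:
  assumes "loewner_le (mean_sigma h A B) (1\<^sub>m n)"
  shows "loewner_le A (matfun (\<lambda>x. 1 / h x) C)"
proof -
  have "dim_row (mean_sigma h A B) = n" using assms by (simp add: loewner_le_iff)
  then have "loewner_le (matfun h C) (T * T)"
    using loewner_le_congruence[OF assms, of T] dims by (simp add: T_sigma_T mat_right_one_dim)
  from loewner_le_inverse[OF hC this] show ?thesis
    unfolding TT inverse_hC inverse_inverse_A .
qed

lemma A_ge:
  assumes "loewner_le (1\<^sub>m n) (mean_sigma h A B)"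
  shows "loewner_le (matfun (\<lambda>x. 1 / h x) C) A"
proof -
  have "loewner_le (T * T) (matfun h C)"
    using loewner_le_congruence[OF assms, of T] dims by (simp add: T_sigma_T mat_right_one_dim)
  moreover have "pd n (T * T)" unfolding TT by (rule pd_matfun[OF A]) simp
  ultimately have "loewner_le (matfun (\<lambda>x. 1 / x) (matfun h C)) (matfun (\<lambda>x. 1 / x) (T * T))"
    by (intro loewner_le_inverse)
  then show ?thesis unfolding TT inverse_hC inverse_inverse_A .
qed

lemma R_matfun_R: "R * matfun u C * R = matfun (\<lambda>x. x * u x) C"
proof -
  have "R * matfun u C * R = matfun (\<lambda>x. sqrt x * u x * sqrt x) C"
    unfolding R_def using dims by (simp add: matfun_mult)
  also have "\<dots> = matfun (\<lambda>x. x * u x) C"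
    by (rule matfun_cong[OF C]) (simp add: sqrt_mult_mult_sqrt)
  finally show ?thesis .
qed

lemma step_le:
  assumes cond: "\<forall>x>0. g (1 / h x) \<le> 1 / h (g x) \<and> g (x / h x) \<le> g x / h (g x) \<and> h (x * g x) \<le> h x * h (g x)"
    and le: "loewner_le (mean_sigma h A B) (1\<^sub>m n)"
  shows "loewner_le (mean_sigma h (matfun (\<lambda>x. x * g x) A) (matfun (\<lambda>x. x * g x) B)) (1\<^sub>m n)"
proof -
  note A1 = A_le[OF le]
  have "loewner_le G (matfun (\<lambda>x. g (1 / h x)) C)"
    using matrix_monotone_on_pd[OF g_mono A A1] dims by (simp add: G_def matfun_compose)
  also have "loewner_le \<dots> (matfun (\<lambda>x. 1 / h (g x)) C)"
    by (rule loewner_le_matfun[OF C]) (use cond in auto)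
  finally (loewner_le_trans) have G1: "loewner_le G (matfun (\<lambda>x. 1 / h (g x)) C)" .
  \<comment> \<open>Congruence by \<open>R\<close> multiplies the bound on \<open>A\<close> by the
    argument, which brings it into the shape of the second condition.\<close>
  have "loewner_le (R * A * R) (matfun (\<lambda>x. x / h x) C)"
    using loewner_le_congruence[OF A1, of R] dims by (simp add: R_matfun_R)
  from matrix_monotone_on_pd[OF g_mono RAR this]
  have "loewner_le (matfun g (R * A * R)) (matfun (\<lambda>x. g (x / h x)) C)"
    using dims by (simp add: matfun_compose)
  also have "loewner_le \<dots> (matfun (\<lambda>x. g x / h (g x)) C)"
    by (rule loewner_le_matfun[OF C]) (use cond in auto)
  finally (loewner_le_trans) have "loewner_le H (R * matfun (\<lambda>x. g x / h (g x)) C * R)"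
    using loewner_le_congruence[of "matfun g (R * A * R)" _ R] dims pdD[OF RAR]
    by (simp add: H_def matfun_dim)
  then have H1: "loewner_le H (matfun (\<lambda>x. x * g x / h (g x)) C)" by (simp add: R_matfun_R)
  have "loewner_le (mean_sigma h G H)
     (mean_sigma h (matfun (\<lambda>x. 1 / h (g x)) C) (matfun (\<lambda>x. x * g x / h (g x)) C))"
    by (rule mean_sigma_mono[OF h_mono _ G H G1 H1]) (use h_pos in auto)
  \<comment> \<open>Both bounds are functions of \<open>C\<close>, so their mean is scalar; their
    quotient is \<open>x * g x\<close>, the argument in the third condition.\<close>
  also have "\<dots> = matfun (\<lambda>x. 1 / h (g x) * h (x * g x / h (g x) / (1 / h (g x)))) C"
    by (rule mean_sigma_matfun[OF C]) (use g_pos h_pos in auto)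
  also have "loewner_le \<dots> (matfun h C)"
  proof (rule loewner_le_matfun[OF C])
    fix x :: real assume x: "x > 0"
    have p: "h (g x) > 0" using x g_pos h_pos by auto
    then have "x * g x / h (g x) / (1 / h (g x)) = x * g x" by simp
    then show "1 / h (g x) * h (x * g x / h (g x) / (1 / h (g x))) \<le> h x"
      using cond x p by (simp add: field_simps)
  qed
  finally (loewner_le_trans) have "loewner_le (mean_sigma h G H) (matfun h C)" .
  from loewner_le_congruence[OF this, of S]
  have "loewner_le (S * mean_sigma h G H * S) (mean_sigma h A B)"
    using dims f_sigma_dim by (simp add: sigma_eq)
  then show ?thesis using le unfolding f_sigma by (rule loewner_le_trans)
qed

text \<open>The mirror image of \<open>step_le\<close>. Monotonicity asks for a positive definite
  smaller matrix, which is now the function of \<open>C\<close>, so its positivity has to be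
  supplied at each use.\<close>

lemma step_ge:
  assumes cond: "\<forall>x>0. g (1 / h x) \<ge> 1 / h (g x) \<and> g (x / h x) \<ge> g x / h (g x) \<and> h (x * g x) \<ge> h x * h (g x)"
    and ge: "loewner_le (1\<^sub>m n) (mean_sigma h A B)"
  shows "loewner_le (1\<^sub>m n) (mean_sigma h (matfun (\<lambda>x. x * g x) A) (matfun (\<lambda>x. x * g x) B))"
proof -
  note A1 = A_ge[OF ge]
  have iC: "pd n (matfun (\<lambda>x. 1 / h x) C)" by (rule pd_matfun[OF C]) (use h_pos in auto)
  have "loewner_le (matfun (\<lambda>x. 1 / h (g x)) C) (matfun (\<lambda>x. g (1 / h x)) C)"
    by (rule loewner_le_matfun[OF C]) (use cond in auto)
  moreover have "loewner_le (matfun (\<lambda>x. g (1 / h x)) C) G"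
    using matrix_monotone_on_pd[OF g_mono iC A1] dims by (simp add: G_def matfun_compose)
  ultimately have G1: "loewner_le (matfun (\<lambda>x. 1 / h (g x)) C) G" by (rule loewner_le_trans)
  have "loewner_le (matfun (\<lambda>x. x / h x) C) (R * A * R)"
    using loewner_le_congruence[OF A1, of R] dims by (simp add: R_matfun_R matfun_dim)
  moreover have "pd n (matfun (\<lambda>x. x / h x) C)" by (rule pd_matfun[OF C]) (use h_pos in auto)
  ultimately have "loewner_le (matfun g (matfun (\<lambda>x. x / h x) C)) (matfun g (R * A * R))"
    by (intro matrix_monotone_on_pd[OF g_mono])
  then have "loewner_le (matfun (\<lambda>x. g (x / h x)) C) (matfun g (R * A * R))"
    using dims by (simp add: matfun_compose)
  moreover have "loewner_le (matfun (\<lambda>x. g x / h (g x)) C) (matfun (\<lambda>x. g (x / h x)) C)"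
    by (rule loewner_le_matfun[OF C]) (use cond in auto)
  ultimately have "loewner_le (matfun (\<lambda>x. g x / h (g x)) C) (matfun g (R * A * R))"
    using loewner_le_trans by blast
  from loewner_le_congruence[OF this, of R]
  have "loewner_le (R * matfun (\<lambda>x. g x / h (g x)) C * R) H" using dims by (simp add: H_def matfun_dim)
  then have H1: "loewner_le (matfun (\<lambda>x. x * g x / h (g x)) C) H" by (simp add: R_matfun_R)
  have "loewner_le (matfun h C) (matfun (\<lambda>x. 1 / h (g x) * h (x * g x / h (g x) / (1 / h (g x)))) C)"
  proof (rule loewner_le_matfun[OF C])
    fix x :: real assume x: "x > 0"
    have p: "h (g x) > 0" using x g_pos h_pos by auto
    then have "x * g x / h (g x) / (1 / h (g x)) = x * g x" by simp
    then show "h x \<le> 1 / h (g x) * h (x * g x / h (g x) / (1 / h (g x)))"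
      using cond x p by (simp add: field_simps)
  qed
  also have "\<dots> = mean_sigma h (matfun (\<lambda>x. 1 / h (g x)) C) (matfun (\<lambda>x. x * g x / h (g x)) C)"
    by (rule mean_sigma_matfun[OF C, symmetric]) (use g_pos h_pos in auto)
  also have "loewner_le \<dots> (mean_sigma h G H)"
    by (rule mean_sigma_mono[OF h_mono _ pd_matfun[OF C] pd_matfun[OF C] G1 H1]) (use g_pos h_pos in auto)
  finally (loewner_le_trans) have "loewner_le (matfun h C) (mean_sigma h G H)" .
  from loewner_le_congruence[OF this, of S]
  have "loewner_le (mean_sigma h A B) (S * mean_sigma h G H * S)"
    using dims by (simp add: sigma_eq matfun_dim)
  with ge show ?thesis unfolding f_sigma by (rule loewner_le_trans)
qed

end

section \<open>Iteration of the step\<close>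

lemma funpow_mult_pos:
  fixes g :: "real \<Rightarrow> real"
  assumes "\<forall>x>0. g x > 0" "x > 0" shows "((\<lambda>x. x * g x) ^^ k) x > 0"
  using assms by (induction k) auto

lemma matfun_funpow_Suc:
  "hermitian A \<Longrightarrow> matfun (f ^^ Suc k) A = matfun f (matfun (f ^^ k) A)"
  by (simp add: matfun_compose comp_def)

theorem theorem2p10:
  fixes n :: nat and A B :: "complex mat" and g h :: "real \<Rightarrow> real"
  assumes A: "pd n A" and B: "pd n B"
    and g_mono: "matrix_monotone_on {0..} g" and h_mono: "matrix_monotone_on {0..} h"
    and g_pos: "\<forall>x>0. g x > 0" and h_pos: "\<forall>x>0. h x > 0"
  shows
   "((\<forall>x>0. g (1 / h x) \<le> 1 / h (g x)
          \<and> g (x / h x) \<le> g x / h (g x)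
          \<and> h (x * g x) \<le> h x * h (g x))
     \<longrightarrow> (\<forall>k\<ge>1. loewner_le (mean_sigma h A B) (1\<^sub>m n) \<longrightarrow>
            loewner_le (mean_sigma h (matfun ((\<lambda>x. x * g x) ^^ k) A)
                                     (matfun ((\<lambda>x. x * g x) ^^ k) B)) (1\<^sub>m n)))
  \<and> ((\<forall>x>0. g (1 / h x) \<ge> 1 / h (g x)
          \<and> g (x / h x) \<ge> g x / h (g x)
          \<and> h (x * g x) \<ge> h x * h (g x))
     \<longrightarrow> (\<forall>k\<ge>1. loewner_le (1\<^sub>m n) (mean_sigma h A B) \<longrightarrow>
            loewner_le (1\<^sub>m n) (mean_sigma h (matfun ((\<lambda>x. x * g x) ^^ k) A)
                                     (matfun ((\<lambda>x. x * g x) ^^ k) B))))"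
proof -
  let ?f = "\<lambda>x. x * g x"
  note h = pdD(3)[OF A] pdD(3)[OF B]
  \<comment> \<open>f maps positive reals to positive reals, so the iterates stay positive definite
    and the single step applies at every stage.\<close>
  have loc: "ando_hiai n (matfun (?f ^^ k) A) (matfun (?f ^^ k) B) g h" for k
    using A B g_mono h_mono g_pos h_pos
    by unfold_locales (auto intro!: pd_matfun funpow_mult_pos)
  have base: "matfun (?f ^^ 0) A = A" "matfun (?f ^^ 0) B = B"
    using h by (auto simp: id_def matfun_ident)
  \<comment> \<open>The induction starts at the identity iterate, where the claim is the hypothesis
    itself.\<close>
  have "loewner_le (mean_sigma h (matfun (?f ^^ k) A) (matfun (?f ^^ k) B)) (1\<^sub>m n)"
    if c: "\<forall>x>0. g (1 / h x) \<le> 1 / h (g x) \<and> g (x / h x) \<le> g x / h (g x) \<and> h (x * g x) \<le> h x * h (g x)"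
      and le: "loewner_le (mean_sigma h A B) (1\<^sub>m n)" for k
  proof (induction k)
    case 0
    show ?case unfolding base by (rule le)
  next
    case (Suc k)
    then show ?case unfolding matfun_funpow_Suc[OF h(1)] matfun_funpow_Suc[OF h(2)]
      by (rule ando_hiai.step_le[OF loc c])
  qed
  moreover have "loewner_le (1\<^sub>m n) (mean_sigma h (matfun (?f ^^ k) A) (matfun (?f ^^ k) B))"
    if c: "\<forall>x>0. g (1 / h x) \<ge> 1 / h (g x) \<and> g (x / h x) \<ge> g x / h (g x) \<and> h (x * g x) \<ge> h x * h (g x)"
      and ge: "loewner_le (1\<^sub>m n) (mean_sigma h A B)" for k
  proof (induction k)
    case 0
    show ?case unfolding base by (rule ge)
  next
    case (Suc k)
    then show ?case unfolding matfun_funpow_Suc[OF h(1)] matfun_funpow_Suc[OF h(2)]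
      by (rule ando_hiai.step_ge[OF loc c])
  qed
  ultimately show ?thesis by blast
qed

end
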